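(* Assume $( * )$. Then there is a compactification $\gamma\omega$ of the discrete space $\omega$ such that the remainder $\gamma\omega\setminus\omega$ is not separable but carries a strictly positive regular probability Borel measure, i.e.\ a regular Borel probability measure that is positive on every nonempty open subset of $\gamma\omega\setminus\omega$.
   Context: Let $\lambda$ be the standard product measure on the Cantor set $2^\omega$. Let $\mathcal E$ be the ideal of all sets $A\subseteq 2^\omega$ with $\lambda(\overline{A})=0$, and let $\kappa_0=\mathrm{cov}(\mathcal E)$ be the least cardinality of a family of sets from $\mathcal E$ covering $2^\omega$. Let $\mathrm{cof}[\kappa_0]^{\le\omega}$ be the least size of a family $\mathcal J$ of countable subsets of $\kappa_0$ such that every countable subset of $\kappa_0$ is contained in some member of $\mathcal J$. Let $\mathfrak b$ be the bounding number. The hypothesis $( * )$ is: $\mathrm{cof}[\kappa_0]^{\le\omega}\le\mathfrak b$. *)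

theory Defs
  imports "HOL-Analysis.Analysis" "HOL-Probability.Probability"
begin

unbundle cardinal_syntax

text \<open>The Cantor set 2^omega is the type nat => bool with the product topology
  (library instance for function spaces, bool discrete). The standard product
  measure lambda is the countable product of the fair coin measure.\<close>

definition cantor_measure :: "(nat \<Rightarrow> bool) measure" where
  "cantor_measure = PiM UNIV (\<lambda>_. measure_pmf (pmf_of_set (UNIV :: bool set)))"

definition ideal_E :: "(nat \<Rightarrow> bool) set set" where
  "ideal_E = {A. closure A \<in> sets cantor_measure \<and> emeasure cantor_measure (closure A) = 0}"

definition E_cover :: "(nat \<Rightarrow> bool) set set \<Rightarrow> bool" where
  "E_cover C \<longleftrightarrow> C \<subseteq> ideal_E \<and> \<Union>C = UNIV"

definition has_card_covE :: "'k set \<Rightarrow> bool" where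
  "has_card_covE K \<longleftrightarrow>
     (\<exists>C. E_cover C \<and> |C| =o |K| ) \<and> (\<forall>C. E_cover C \<longrightarrow> |K| \<le>o |C| )"

definition unbounded_family :: "(nat \<Rightarrow> nat) set \<Rightarrow> bool" where
  "unbounded_family B \<longleftrightarrow>
     \<not> (\<exists>g. \<forall>f\<in>B. eventually (\<lambda>n. f n \<le> g n) sequentially)"

definition cof_countable_le_b :: "'k set \<Rightarrow> bool" where
  "cof_countable_le_b K \<longleftrightarrow>
     (\<exists>J. (\<forall>j\<in>J. j \<subseteq> K \<and> countable j)
        \<and> (\<forall>S. S \<subseteq> K \<and> countable S \<longrightarrow> (\<exists>j\<in>J. S \<subseteq> j))
        \<and> (\<forall>B. unbounded_family B \<longrightarrow> |J| \<le>o |B| ))"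

definition hypothesis_star :: "'k set \<Rightarrow> bool" where
  "hypothesis_star K \<longleftrightarrow> has_card_covE K \<and> cof_countable_le_b K"

definition compactification_of_omega :: "'a topology \<Rightarrow> (nat \<Rightarrow> 'a) \<Rightarrow> bool" where
  "compactification_of_omega G e \<longleftrightarrow>
     compact_space G \<and> Hausdorff_space G
     \<and> embedding_map (discrete_topology UNIV) G e
     \<and> G closure_of (range e) = topspace G"

definition borel_of_top :: "'a topology \<Rightarrow> 'a measure" where
  "borel_of_top T = sigma (topspace T) {U. openin T U}"

definition regular_borel_prob :: "'a topology \<Rightarrow> 'a measure \<Rightarrow> bool" where
  "regular_borel_prob T \<mu> \<longleftrightarrow>
     space \<mu> = topspace T \<and> sets \<mu> = sets (borel_of_top T) \<and> prob_space \<mu>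
     \<and> (\<forall>A\<in>sets \<mu>. emeasure \<mu> A = (SUP F\<in>{F. closedin T F \<and> F \<subseteq> A}. emeasure \<mu> F))
     \<and> (\<forall>A\<in>sets \<mu>. emeasure \<mu> A = (INF U\<in>{U. openin T U \<and> A \<subseteq> U}. emeasure \<mu> U))"

definition strictly_positive :: "'a topology \<Rightarrow> 'a measure \<Rightarrow> bool" where
  "strictly_positive T \<mu> \<longleftrightarrow> (\<forall>U. openin T U \<and> U \<noteq> {} \<longrightarrow> emeasure \<mu> U > 0)"

end

theory Submission
  imports Defs
begin

text \<open>
  One builds a Boolean algebra of pairs \<open>(A, X)\<close>, where \<open>A \<subseteq> \<omega>\<close> and \<open>X \<subseteq> 2\<^sup>\<omega>\<close> is measurable, such that
  \<open>A\<close> is finite iff \<open>X\<close> is null. The first components form an algebra whose Stone space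
  is the compactification, and the product measure of the second components gives a strictly positive
  content on the clopen subsets of the remainder, which extends to a regular Borel measure.

  One starts with the clopen sets \<open>X\<close>, paired with the indices of the terms in \<open>X\<close> of a dense
  sequence. Let \<open>J\<close> be a cofinal family of countable sets of indices of a cover of \<open>2\<^sup>\<omega>\<close> by closed null
  sets. For every \<open>j \<in> J\<close> one adjoins a pair \<open>(B, C)\<close> where \<open>C\<close> is a closed set of positive measure that
  misses all null sets indexed by \<open>j\<close>. As fewer than \<open>\<bb>\<close> pairs are present at each stage, one can
  dominate all the functions involved; this gives a \<open>C\<close> which meets each \<open>X\<close> in positive measure unless
  \<open>X\<close> is almost covered by finitely many clopen pieces of the complement of \<open>C\<close>, and then a \<open>B\<close> that
  keeps finiteness and nullity equivalent.

  Each point of the remainder lies over a point of \<open>2\<^sup>\<omega>\<close>. Given countably many of them, some \<open>j\<close>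
  covers the points below, and the clopen set given by the corresponding \<open>B\<close> contains none of them.
\<close>

subsection \<open>The Cantor measure on clopen sets\<close>

text \<open>These are the clopen subsets of the Cantor set. One implication suffices, since
  agreement below \<open>n\<close> is symmetric in \<open>x\<close> and \<open>y\<close>.\<close>

definition finitely_determined :: "(nat \<Rightarrow> bool) set \<Rightarrow> bool" where
  "finitely_determined X \<longleftrightarrow> (\<exists>n. \<forall>x y. (\<forall>i<n. x i = y i) \<longrightarrow> x \<in> X \<longrightarrow> y \<in> X)"

lemma finitely_determined_empty: "finitely_determined {}"
  by (auto simp: finitely_determined_def)

lemma finitely_determined_Compl:
  assumes "finitely_determined X"
  shows "finitely_determined (- X)"
proof -
  obtain n where "\<And>x y. (\<forall>i<n. x i = y i) \<Longrightarrow> x \<in> X \<Longrightarrow> y \<in> X"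
    using assms unfolding finitely_determined_def by blast
  then have "\<forall>x y. (\<forall>i<n. x i = y i) \<longrightarrow> x \<in> - X \<longrightarrow> y \<in> - X"
    by (metis ComplD ComplI)
  then show ?thesis
    unfolding finitely_determined_def by blast
qed

lemma finitely_determined_Un:
  assumes "finitely_determined X" "finitely_determined Y"
  shows "finitely_determined (X \<union> Y)"
proof -
  obtain n k where n: "\<And>x y. (\<forall>i<n. x i = y i) \<Longrightarrow> x \<in> X \<Longrightarrow> y \<in> X"
    and k: "\<And>x y. (\<forall>i<k. x i = y i) \<Longrightarrow> x \<in> Y \<Longrightarrow> y \<in> Y"
    using assms unfolding finitely_determined_def by metis
  have "y \<in> X \<union> Y" if "\<forall>i<max n k. x i = y i" "x \<in> X \<union> Y" for x y
    using that n[of x y] k[of x y] by auto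
  then show ?thesis
    unfolding finitely_determined_def by blast
qed

lemma finitely_determined_coordinate: "finitely_determined {x. x i}"
  unfolding finitely_determined_def by (rule exI[of _ "Suc i"]) auto

text \<open>A finite code for clopen sets, from which countability and measurability are read
  off.\<close>

lemma finitely_determined_iff_lists:
  "finitely_determined X \<longleftrightarrow> (\<exists>n L. L \<subseteq> {l. length l = n} \<and> X = {x. map x [0..<n] \<in> L})"
proof
  assume "finitely_determined X"
  then obtain n where n: "\<And>x y. (\<forall>i<n. x i = y i) \<Longrightarrow> x \<in> X \<Longrightarrow> y \<in> X"
    unfolding finitely_determined_def by blast
  have "x \<in> X" if "map x [0..<n] = map y [0..<n]" "y \<in> X" for x y
    by (rule n[OF _ that(2)]) (use that(1) in \<open>auto simp: map_eq_conv\<close>)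
  then have "X = {x. map x [0..<n] \<in> (\<lambda>x. map x [0..<n]) ` X}"
    by blast
  then show "\<exists>n L. L \<subseteq> {l. length l = n} \<and> X = {x. map x [0..<n] \<in> L}"
    by (intro exI[of _ n] exI[of _ "(\<lambda>x. map x [0..<n]) ` X"]) auto
next
  assume "\<exists>n L. L \<subseteq> {l. length l = n} \<and> X = {x. map x [0..<n] \<in> L}"
  then obtain n L where X: "X = {x. map x [0..<n] \<in> L}"
    by blast
  have "map x [0..<n] = map y [0..<n]" if "\<forall>i<n. x i = y i" for x y :: "nat \<Rightarrow> bool"
    using that by (simp add: map_eq_conv)
  then show "finitely_determined X"
    unfolding finitely_determined_def X by (metis mem_Collect_eq)
qed

lemma countable_finitely_determined: "countable {X. finitely_determined X}"
proof -
  have "{X. finitely_determined X} \<subseteq>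
      (\<lambda>(n, L). {x. map x [0..<n] \<in> L}) ` (UNIV \<times> {L :: bool list set. finite L})"
  proof clarify
    fix X assume "finitely_determined X"
    then obtain n L where L: "L \<subseteq> {l. length l = n}" "X = {x. map x [0..<n] \<in> L}"
      unfolding finitely_determined_iff_lists by blast
    have "finite {l :: bool list. set l \<subseteq> UNIV \<and> length l = n}"
      by (rule finite_lists_length_eq) simp
    then have "finite L"
      using L(1) by (simp add: finite_subset)
    then show "X \<in> (\<lambda>(n, L). {x. map x [0..<n] \<in> L}) ` (UNIV \<times> {L. finite L})"
      using L(2) by (intro image_eqI[of _ _ "(n, L)"]) auto
  qed
  then show ?thesis
    by (rule countable_subset) (intro countable_image countable_SIGMA countable_Collect_finite; simp)
qed

interpretation coins: product_prob_space "\<lambda>_::nat. measure_pmf (pmf_of_set (UNIV :: bool set))" UNIV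
  by unfold_locales

lemma prob_space_cantor_measure: "prob_space cantor_measure"
  unfolding cantor_measure_def by (rule coins.prob_space_axioms)

lemma space_cantor_measure [simp]: "space cantor_measure = UNIV"
  by (simp add: cantor_measure_def space_PiM)

lemma cylinder_measurable: "{x. \<forall>i<n. x i = y i} \<in> sets cantor_measure"
  and emeasure_cylinder: "emeasure cantor_measure {x. \<forall>i<n. x i = y i} = ennreal ((1/2) ^ n)"
proof -
  let ?M = "\<lambda>_::nat. measure_pmf (pmf_of_set (UNIV :: bool set))"
  have eq: "{x. \<forall>i<n. x i = y i} = prod_emb UNIV ?M {..<n} (Pi\<^sub>E {..<n} (\<lambda>i. {y i}))"
    by (rule set_eqI) (auto simp: prod_emb_iff PiE_iff)
  show "{x. \<forall>i<n. x i = y i} \<in> sets cantor_measure"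
    unfolding eq cantor_measure_def by (rule sets_PiM_I) auto
  have half: "emeasure (measure_pmf (pmf_of_set (UNIV :: bool set))) {b} = ennreal (1/2)" for b
    by (simp add: emeasure_pmf_single)
  have "emeasure cantor_measure {x. \<forall>i<n. x i = y i} = (\<Prod>i<n. emeasure (?M i) {y i})"
    unfolding eq cantor_measure_def by (rule coins.emeasure_PiM_emb) auto
  also have "\<dots> = ennreal (1/2) ^ n"
    unfolding half by simp
  also have "\<dots> = ennreal ((1/2) ^ n)"
    by (rule ennreal_power) simp
  finally show "emeasure cantor_measure {x. \<forall>i<n. x i = y i} = ennreal ((1/2) ^ n)" .
qed

lemma finitely_determined_measurable:
  assumes "finitely_determined X"
  shows "X \<in> sets cantor_measure"
proof -
  obtain n L where L: "L \<subseteq> {l. length l = n}" and X: "X = {x. map x [0..<n] \<in> L}"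
    using assms unfolding finitely_determined_iff_lists by blast
  have "{x. map x [0..<n] = l} = {x. \<forall>i<n. x i = l ! i}" if "l \<in> L" for l
    using that L by (auto simp: list_eq_iff_nth_eq)
  moreover have "X = (\<Union>l\<in>L. {x. map x [0..<n] = l})"
    unfolding X by auto
  ultimately have "X = (\<Union>l\<in>L. {x. \<forall>i<n. x i = l ! i})"
    by simp
  also have "\<dots> \<in> sets cantor_measure"
    by (rule sets.countable_UN') (auto simp: cylinder_measurable)
  finally show ?thesis .
qed

text \<open>A nonempty clopen set contains a cylinder, whose measure is a power of 1/2.\<close>

lemma finitely_determined_positive:
  assumes "finitely_determined X" "X \<noteq> {}"
  shows "emeasure cantor_measure X > 0"
proof -
  obtain n where n: "\<And>x y. (\<forall>i<n. x i = y i) \<Longrightarrow> x \<in> X \<Longrightarrow> y \<in> X"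
    using assms unfolding finitely_determined_def by blast
  obtain y where "y \<in> X" using assms by blast
  then have "{x. \<forall>i<n. x i = y i} \<subseteq> X"
    using n[of y] by auto
  then have "emeasure cantor_measure {x. \<forall>i<n. x i = y i} \<le> emeasure cantor_measure X"
    using finitely_determined_measurable[OF assms(1)] by (rule emeasure_mono)
  then show ?thesis
    unfolding emeasure_cylinder by (rule less_le_trans[rotated]) simp
qed

section \<open>Clopen neighbourhoods of closed null sets\<close>

definition thicken :: "(nat \<Rightarrow> bool) set \<Rightarrow> nat \<Rightarrow> (nat \<Rightarrow> bool) set" where
  "thicken E n = {x. \<exists>y\<in>E. \<forall>i<n. x i = y i}"

lemma subset_thicken: "E \<subseteq> thicken E n"
  by (auto simp: thicken_def)

lemma finitely_determined_thicken: "finitely_determined (thicken E n)"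
  unfolding finitely_determined_def thicken_def by (rule exI[of _ n]) auto

text \<open>A point in all thickenings is the limit of points of \<open>E\<close> that agree with it
  on longer and longer initial segments.\<close>

lemma INT_thicken_closed:
  assumes "closed E"
  shows "(\<Inter>n. thicken E n) = E"
proof
  show "(\<Inter>n. thicken E n) \<subseteq> E"
  proof
    fix x assume "x \<in> (\<Inter>n. thicken E n)"
    then obtain y where y: "\<And>n. y n \<in> E" "\<And>n i. i < n \<Longrightarrow> x i = y n i"
      unfolding thicken_def by simp metis
    have "y \<longlonglongrightarrow> x"
    proof -
      have "eventually (\<lambda>n. y n i = x i) sequentially" for i
        using y(2) by (intro eventually_sequentiallyI[of "Suc i"]) (metis Suc_le_lessD)
      then have "(\<lambda>n. y n i) \<longlonglongrightarrow> x i" for i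
        by (rule tendsto_eventually)
      then have "limitin (product_topology (\<lambda>_. euclidean) UNIV) y x sequentially"
        by (simp add: limitin_componentwise)
      then show ?thesis
        by (simp add: euclidean_product_topology)
    qed
    then show "x \<in> E"
      using assms y(1) closed_sequentially by blast
  qed
qed (use subset_thicken in blast)

text \<open>Continuity from above along the decreasing thickenings. This is where closedness
  matters: a null set with full closure has no small clopen neighbourhood.\<close>

lemma ex_thicken_small:
  assumes "closed E" "emeasure cantor_measure E = 0" "0 < \<epsilon>"
  shows "\<exists>n. emeasure cantor_measure (thicken E n) < \<epsilon>"
proof -
  interpret prob_space cantor_measure by (rule prob_space_cantor_measure)
  have "(\<lambda>n. emeasure cantor_measure (thicken E n)) \<longlonglongrightarrow> emeasure cantor_measure (\<Inter>n. thicken E n)"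
  proof (rule Lim_emeasure_decseq)
    show "range (thicken E) \<subseteq> sets cantor_measure"
      using finitely_determined_measurable finitely_determined_thicken by blast
    show "decseq (thicken E)"
      by (force simp: decseq_def thicken_def)
  qed simp
  then have "eventually (\<lambda>n. emeasure cantor_measure (thicken E n) < \<epsilon>) sequentially"
    using assms by (intro order_tendstoD(2)) (auto simp: INT_thicken_closed)
  then show ?thesis
    by (metis eventually_happens trivial_limit_sequentially)
qed

text \<open>The second component of the decoded pair is ignored, so that each finite pattern is hit by
  infinitely many indices.\<close>
definition dense_seq :: "nat \<Rightarrow> nat \<Rightarrow> bool" where
  "dense_seq k i \<longleftrightarrow> (let l = fst (from_nat k :: bool list \<times> nat) in i < length l \<and> l ! i)"

lemma infinite_dense_seq:
  assumes "finitely_determined X" "X \<noteq> {}"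
  shows "infinite {k. dense_seq k \<in> X}"
proof -
  obtain n where n: "\<And>x y. (\<forall>i<n. x i = y i) \<Longrightarrow> x \<in> X \<Longrightarrow> y \<in> X"
    using assms(1) unfolding finitely_determined_def by blast
  obtain x where x: "x \<in> X" using assms(2) by blast
  \<comment> \<open>The pattern of \<open>x\<close> below \<open>n\<close> is encoded together with
    an arbitrary \<open>j\<close>, which gives infinitely many indices.\<close>
  have "range (\<lambda>j::nat. to_nat (map x [0..<n], j)) \<subseteq> {k. dense_seq k \<in> X}"
  proof clarify
    fix j :: nat
    show "dense_seq (to_nat (map x [0..<n], j)) \<in> X"
      by (rule n[OF _ x]) (simp add: dense_seq_def)
  qed
  moreover have "infinite (range (\<lambda>j::nat. to_nat (map x [0..<n], j)))"
    by (intro range_inj_infinite injI) simp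
  ultimately show ?thesis
    using finite_subset by blast
qed

subsection \<open>Boolean algebras of pairs\<close>

text \<open>A stand-in for \<open>|R| < \<bb>\<close> that avoids naming the cardinal \<open>\<bb>\<close>.\<close>
definition b_small :: "'r set \<Rightarrow> bool" where
  "b_small R \<longleftrightarrow> (\<forall>h :: 'r \<Rightarrow> nat \<Rightarrow> nat. \<not> unbounded_family (h ` R))"

lemma b_small_dominated:
  assumes "b_small R"
  shows "\<exists>g. \<forall>r\<in>R. \<forall>\<^sub>F n in sequentially. h r n \<le> (g n :: nat)"
  using assms unfolding b_small_def unbounded_family_def by blast

text \<open>Domination transported along a coding of the countable type; needed below for functions
  on finite sequences.\<close>

lemma b_small_dominated_countable:
  fixes h :: "'r \<Rightarrow> 's::countable \<Rightarrow> nat"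
  assumes "b_small R"
  shows "\<exists>g. \<forall>r\<in>R. finite {s. g s < h r s}"
proof -
  obtain g where g: "\<And>r. r \<in> R \<Longrightarrow> \<forall>\<^sub>F n in sequentially. h r (from_nat n) \<le> g n"
    using b_small_dominated[OF assms, of "\<lambda>r n. h r (from_nat n)"] by blast
  have "finite {s. g (to_nat s) < h r s}" if r: "r \<in> R" for r
  proof -
    obtain N where N: "\<And>n. N \<le> n \<Longrightarrow> h r (from_nat n) \<le> g n"
      using g[OF r] unfolding eventually_sequentially by blast
    have "to_nat s < N" if "g (to_nat s) < h r s" for s
      using N[of "to_nat s"] that by (cases "N \<le> to_nat s") auto
    then have "to_nat ` {s. g (to_nat s) < h r s} \<subseteq> {..<N}"
      by auto
    then have "finite (to_nat ` {s. g (to_nat s) < h r s})"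
      by (rule finite_subset) simp
    then show ?thesis
      by (rule finite_imageD) (rule inj_on_subset[OF inj_to_nat], simp)
  qed
  then show ?thesis
    by (intro exI[of _ "\<lambda>s. g (to_nat s)"]) simp
qed

text \<open>Diagonalisation: the sum of the first \<open>n + 1\<close> functions at \<open>n\<close>
  eventually bounds each of them.\<close>

lemma b_small_countable:
  assumes "countable R"
  shows "b_small R"
  unfolding b_small_def unbounded_family_def not_not
proof
  fix h :: "'a \<Rightarrow> nat \<Rightarrow> nat"
  let ?g = "\<lambda>n. \<Sum>k\<le>n. h (from_nat_into R k) n"
  have "\<forall>\<^sub>F n in sequentially. h r n \<le> ?g n" if r: "r \<in> R" for r
  proof (rule eventually_sequentiallyI)
    fix n assume n: "to_nat_on R r \<le> n"
    have "h r n = h (from_nat_into R (to_nat_on R r)) n"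
      using assms r by simp
    also have "\<dots> \<le> ?g n"
      using n by (intro member_le_sum[of _ _ "\<lambda>k. h (from_nat_into R k) n"]) auto
    finally show "h r n \<le> ?g n" .
  qed
  then show "\<exists>g. \<forall>f\<in>h ` R. \<forall>\<^sub>F n in sequentially. f n \<le> g n"
    by (intro exI[of _ ?g]) simp
qed

text \<open>An unbounded image of \<open>R\<close> would have at least \<open>|J|\<close> elements,
  more than \<open>R\<close> has.\<close>

lemma b_small_ordLess:
  fixes J :: "'j set" and R :: "'r set"
  assumes J: "\<And>B. unbounded_family B \<Longrightarrow> |J| \<le>o |B|" and "|R| <o |J|"
  shows "b_small R"
  unfolding b_small_def
proof (intro allI notI)
  fix h :: "'r \<Rightarrow> nat \<Rightarrow> nat"
  assume "unbounded_family (h ` R)"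
  then have "|J| \<le>o |h ` R|"
    by (rule J)
  also have "|h ` R| \<le>o |R|"
    by (rule card_of_image)
  finally (ordLeq_transitive) show False
    using assms(2) not_ordLess_ordLeq by blast
qed

section \<open>Boolean subalgebras of a product of two power sets\<close>

definition pair_algebra :: "('a set \<times> 'b set) set \<Rightarrow> bool" where
  "pair_algebra R \<longleftrightarrow> ({}, {}) \<in> R \<and> (\<forall>A X. (A, X) \<in> R \<longrightarrow> (- A, - X) \<in> R) \<and>
     (\<forall>A X B Y. (A, X) \<in> R \<longrightarrow> (B, Y) \<in> R \<longrightarrow> (A \<union> B, X \<union> Y) \<in> R)"

lemma pair_algebra_empty: "pair_algebra R \<Longrightarrow> ({}, {}) \<in> R"
  and pair_algebra_Compl: "pair_algebra R \<Longrightarrow> (A, X) \<in> R \<Longrightarrow> (- A, - X) \<in> R"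
  and pair_algebra_Un:
    "pair_algebra R \<Longrightarrow> (A, X) \<in> R \<Longrightarrow> (B, Y) \<in> R \<Longrightarrow> (A \<union> B, X \<union> Y) \<in> R"
  unfolding pair_algebra_def by blast+

lemma pair_algebra_UNIV: "pair_algebra R \<Longrightarrow> (UNIV, UNIV) \<in> R"
  using pair_algebra_Compl[OF _ pair_algebra_empty] by fastforce

lemma pair_algebra_Int:
  assumes "pair_algebra R" "(A, X) \<in> R" "(B, Y) \<in> R"
  shows "(A \<inter> B, X \<inter> Y) \<in> R"
proof -
  have "(- (- A \<union> - B), - (- X \<union> - Y)) \<in> R"
    using assms by (intro pair_algebra_Compl pair_algebra_Un)
  then show ?thesis by simp
qed

lemma pair_algebra_Diff:
  assumes "pair_algebra R" "(A, X) \<in> R" "(B, Y) \<in> R"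
  shows "(A - B, X - Y) \<in> R"
  using pair_algebra_Int[OF assms(1,2) pair_algebra_Compl[OF assms(1,3)]] by (simp add: Diff_eq)

lemma pair_algebra_Union:
  assumes "\<S> \<noteq> {}" "\<And>R. R \<in> \<S> \<Longrightarrow> pair_algebra R"
    and chain: "\<And>R R'. R \<in> \<S> \<Longrightarrow> R' \<in> \<S> \<Longrightarrow> R \<subseteq> R' \<or> R' \<subseteq> R"
  shows "pair_algebra (\<Union>\<S>)"
  unfolding pair_algebra_def
proof (intro conjI allI impI)
  show "({}, {}) \<in> \<Union>\<S>"
    using assms(1,2) pair_algebra_empty by blast
  show "(- A, - X) \<in> \<Union>\<S>" if "(A, X) \<in> \<Union>\<S>" for A X
    using that assms(2) pair_algebra_Compl by blast
  show "(A \<union> B, X \<union> Y) \<in> \<Union>\<S>" if "(A, X) \<in> \<Union>\<S>" "(B, Y) \<in> \<Union>\<S>" for A X B Y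
  proof -
    obtain R R' where R: "R \<in> \<S>" "R' \<in> \<S>" "(A, X) \<in> R" "(B, Y) \<in> R'"
      using \<open>(A, X) \<in> \<Union>\<S>\<close> \<open>(B, Y) \<in> \<Union>\<S>\<close> by blast
    then have "\<exists>Q\<in>\<S>. (A, X) \<in> Q \<and> (B, Y) \<in> Q"
      using chain[OF R(1,2)] by blast
    then show ?thesis
      using assms(2) pair_algebra_Un by blast
  qed
qed

text \<open>For an algebra \<open>R\<close> this is the algebra generated by \<open>R\<close> and
  \<open>(B, C)\<close>, its elements written in normal form.\<close>

definition adjoin :: "('a set \<times> 'b set) set \<Rightarrow> 'a set \<Rightarrow> 'b set \<Rightarrow> ('a set \<times> 'b set) set" where
  "adjoin R B C = (\<lambda>((A, X), (A', X')). ((A \<inter> B) \<union> (A' - B), (X \<inter> C) \<union> (X' - C))) ` (R \<times> R)"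

lemma adjoinI:
  "(A, X) \<in> R \<Longrightarrow> (A', X') \<in> R \<Longrightarrow> ((A \<inter> B) \<union> (A' - B), (X \<inter> C) \<union> (X' - C)) \<in> adjoin R B C"
  unfolding adjoin_def by (rule image_eqI[of _ _ "((A, X), (A', X'))"]) auto

lemma adjoinE:
  assumes "(D, Y) \<in> adjoin R B C"
  obtains A X A' X' where "(A, X) \<in> R" "(A', X') \<in> R"
    "D = (A \<inter> B) \<union> (A' - B)" "Y = (X \<inter> C) \<union> (X' - C)"
  using assms unfolding adjoin_def by auto

lemma subset_adjoin: "R \<subseteq> adjoin R B C"
proof clarify
  fix A X assume "(A, X) \<in> R"
  from adjoinI[OF this this, of B C] show "(A, X) \<in> adjoin R B C"
    by (simp add: Int_Diff_Un)
qed

lemma mem_adjoin: "pair_algebra R \<Longrightarrow> (B, C) \<in> adjoin R B C"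
  using adjoinI[OF pair_algebra_UNIV pair_algebra_empty, of R B C] by simp

lemma pair_algebra_adjoin:
  assumes "pair_algebra R"
  shows "pair_algebra (adjoin R B C)"
  unfolding pair_algebra_def
proof (intro conjI allI impI)
  show "({}, {}) \<in> adjoin R B C"
    using pair_algebra_empty[OF assms] subset_adjoin by blast
next
  fix D Y assume "(D, Y) \<in> adjoin R B C"
  then obtain A X A' X' where *: "(A, X) \<in> R" "(A', X') \<in> R"
    "D = (A \<inter> B) \<union> (A' - B)" "Y = (X \<inter> C) \<union> (X' - C)"
    by (rule adjoinE)
  have "- D = (- A \<inter> B) \<union> (- A' - B)" "- Y = (- X \<inter> C) \<union> (- X' - C)"
    using * by auto
  then show "(- D, - Y) \<in> adjoin R B C"
    using adjoinI[OF pair_algebra_Compl[OF assms *(1)] pair_algebra_Compl[OF assms *(2)], of B C]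
    by simp
next
  fix D Y D' Y' assume "(D, Y) \<in> adjoin R B C" "(D', Y') \<in> adjoin R B C"
  then obtain A X A' X' F Z F' Z' where *: "(A, X) \<in> R" "(A', X') \<in> R"
    "D = (A \<inter> B) \<union> (A' - B)" "Y = (X \<inter> C) \<union> (X' - C)" "(F, Z) \<in> R" "(F', Z') \<in> R"
    "D' = (F \<inter> B) \<union> (F' - B)" "Y' = (Z \<inter> C) \<union> (Z' - C)"
    by (meson adjoinE)
  have "D \<union> D' = ((A \<union> F) \<inter> B) \<union> ((A' \<union> F') - B)" "Y \<union> Y' = ((X \<union> Z) \<inter> C) \<union> ((X' \<union> Z') - C)"
    using * by auto
  then show "(D \<union> D', Y \<union> Y') \<in> adjoin R B C"
    using adjoinI[OF pair_algebra_Un[OF assms *(1,5)] pair_algebra_Un[OF assms *(2,6)], of B C]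
    by simp
qed

text \<open>On a pair algebra this says that \<open>A\<close> modulo finite sets and
  \<open>X\<close> modulo null sets determine each other, so the two quotients are
  isomorphic.\<close>

definition faithful :: "(nat set \<times> (nat \<Rightarrow> bool) set) set \<Rightarrow> bool" where
  "faithful R \<longleftrightarrow> (\<forall>A X. (A, X) \<in> R \<longrightarrow>
     X \<in> sets cantor_measure \<and> (finite A \<longleftrightarrow> measure cantor_measure X = 0))"

definition dense_trace :: "(nat \<Rightarrow> bool) set \<Rightarrow> nat set" where
  "dense_trace X = {k. dense_seq k \<in> X}"

lemma dense_trace_Compl: "dense_trace (- X) = - dense_trace X"
  and dense_trace_Un: "dense_trace (X \<union> Y) = dense_trace X \<union> dense_trace Y"
  and dense_trace_empty: "dense_trace {} = {}"
  by (auto simp: dense_trace_def)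

text \<open>Finite errors are allowed in the first component so that all finite sets belong to the
  algebra.\<close>

definition base_pairs :: "(nat set \<times> (nat \<Rightarrow> bool) set) set" where
  "base_pairs = {(A, X). finitely_determined X \<and> finite (sym_diff A (dense_trace X))}"

lemma trace_base_pairs: "finitely_determined X \<Longrightarrow> (dense_trace X, X) \<in> base_pairs"
  by (simp add: base_pairs_def)

lemma finite_base_pairs: "finite A \<Longrightarrow> (A, {}) \<in> base_pairs"
  by (simp add: base_pairs_def finitely_determined_empty dense_trace_empty)

lemma countable_base_pairs: "countable base_pairs"
proof -
  have "base_pairs \<subseteq> (\<lambda>(X, F). (sym_diff F (dense_trace X), X)) ` ({X. finitely_determined X} \<times> {F. finite F})"
  proof clarify
    fix A X assume "(A, X) \<in> base_pairs"
    then have "finitely_determined X" "finite (sym_diff A (dense_trace X))"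
      by (auto simp: base_pairs_def)
    then show "(A, X) \<in> (\<lambda>(X, F). (sym_diff F (dense_trace X), X)) ` ({X. finitely_determined X} \<times> {F. finite F})"
      by (intro image_eqI[of _ _ "(X, sym_diff A (dense_trace X))"]) auto
  qed
  then show ?thesis
    by (rule countable_subset)
      (intro countable_image countable_SIGMA countable_finitely_determined countable_Collect_finite)
qed

lemma pair_algebra_base_pairs: "pair_algebra base_pairs"
  unfolding pair_algebra_def
proof (intro conjI allI impI)
  show "({}, {}) \<in> base_pairs"
    by (simp add: finite_base_pairs)
next
  fix A X assume "(A, X) \<in> base_pairs"
  then show "(- A, - X) \<in> base_pairs"
    by (simp add: base_pairs_def finitely_determined_Compl dense_trace_Compl Diff_eq Int_commute)
next
  fix A X B Y assume "(A, X) \<in> base_pairs" "(B, Y) \<in> base_pairs"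
  then have "finitely_determined (X \<union> Y)"
    "finite (sym_diff A (dense_trace X) \<union> sym_diff B (dense_trace Y))"
    by (auto simp: base_pairs_def finitely_determined_Un)
  moreover have "sym_diff (A \<union> B) (dense_trace (X \<union> Y))
      \<subseteq> sym_diff A (dense_trace X) \<union> sym_diff B (dense_trace Y)"
    by (auto simp: dense_trace_Un)
  ultimately show "(A \<union> B, X \<union> Y) \<in> base_pairs"
    unfolding base_pairs_def using finite_subset by blast
qed

text \<open>Both conditions amount to \<open>X = {}\<close>: a nonempty clopen set has positive
  measure and infinite trace.\<close>

lemma faithful_base_pairs: "faithful base_pairs"
  unfolding faithful_def
proof (intro allI impI)
  fix A X assume "(A, X) \<in> base_pairs"
  then have X: "finitely_determined X" and fin: "finite (sym_diff A (dense_trace X))"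
    by (auto simp: base_pairs_def)
  interpret prob_space cantor_measure by (rule prob_space_cantor_measure)
  have "finite A \<longleftrightarrow> finite (dense_trace X)"
  proof
    assume "finite A"
    then show "finite (dense_trace X)"
      by (rule finite_subset[rotated, OF finite_UnI[OF _ fin]]) auto
  next
    assume "finite (dense_trace X)"
    then show "finite A"
      by (rule finite_subset[rotated, OF finite_UnI[OF _ fin]]) auto
  qed
  also have "\<dots> \<longleftrightarrow> X = {}"
    using infinite_dense_seq[OF X] by (cases "X = {}") (auto simp: dense_trace_def)
  also have "\<dots> \<longleftrightarrow> measure cantor_measure X = 0"
    using finitely_determined_positive[OF X] by (cases "X = {}") (auto simp: emeasure_eq_measure)
  finally show "X \<in> sets cantor_measure \<and> (finite A \<longleftrightarrow> measure cantor_measure X = 0)"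
    using finitely_determined_measurable[OF X] by blast
qed

subsection \<open>Adjoining one pair\<close>

lemma dense_trace_mono: "X \<subseteq> Y \<Longrightarrow> dense_trace X \<subseteq> dense_trace Y"
  by (auto simp: dense_trace_def)

text \<open>\<open>W n\<close> is a union of thickenings of \<open>E 0, \<dots>, E (n - 1)\<close> whose parameters are chosen recursively, the
  next one as a function \<open>g'\<close> of the finite sequence of the previous ones. Letting \<open>g'\<close> dominate makes
  the thickenings eventually negligible compared with what is left of every \<open>X\<close>.\<close>
lemma fat_closed_set_exists:
  fixes E :: "nat \<Rightarrow> (nat \<Rightarrow> bool) set"
  assumes small: "b_small R"
    and closed: "\<And>i. closed (E i)" and null: "\<And>i. emeasure cantor_measure (E i) = 0"
    and meas: "snd ` R \<subseteq> sets cantor_measure"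
  shows "\<exists>W :: nat \<Rightarrow> (nat \<Rightarrow> bool) set. incseq W \<and> (\<forall>n. finitely_determined (W n)) \<and>
    (\<Union>i. E i) \<subseteq> (\<Union>n. W n) \<and> measure cantor_measure (- (\<Union>n. W n)) > 0 \<and>
    (\<forall>A X. (A, X) \<in> R \<longrightarrow> (\<forall>n. measure cantor_measure (X - W n) > 0) \<longrightarrow>
       measure cantor_measure (X - (\<Union>n. W n)) > 0)"
proof -
  interpret prob_space cantor_measure by (rule prob_space_cantor_measure)
  have "\<exists>n. measure cantor_measure (thicken (E i) n) < (1/2) ^ k" for i k
    using ex_thicken_small[OF closed null, of "ennreal ((1/2) ^ k)" i]
    by (simp add: emeasure_eq_measure ennreal_less_iff)
  then obtain N where N: "\<And>i k. measure cantor_measure (thicken (E i) (N i k)) < (1/2) ^ k"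
    by metis
  define V where "V i k = thicken (E i) (N i k)" for i k
  have V: "finitely_determined (V i k)" "E i \<subseteq> V i k" "prob (V i k) \<le> (1/2) ^ k" for i k
    using N[of i k] by (auto simp: V_def finitely_determined_thicken subset_thicken[THEN subsetD])
  \<comment> \<open>Entry \<open>i\<close> of \<open>s\<close> is the parameter of the thickening of
    \<open>E i\<close>, so \<open>U s\<close> is what has been removed after the choices in
    \<open>s\<close>.\<close>
  define U where "U s = (\<Union>i<length s. V i (s ! i))" for s :: "nat list"
  have fd_UN: "finitely_determined (\<Union>i<n. V i (f i))" for n :: nat and f
    by (induction n) (auto simp: lessThan_Suc finitely_determined_empty intro!: finitely_determined_Un V)
  have fd_U: "finitely_determined (U s)" for s
    unfolding U_def by (rule fd_UN)
  \<comment> \<open>With \<open>n\<close> the length of \<open>s\<close>, a next thickening of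
    parameter \<open>F X s\<close> has measure at most 2^-(n+2) times what is left of
    \<open>X\<close>. The choice is meaningful only if something is left.\<close>
  define F where "F X s = (SOME k. (1/2) ^ k \<le> (1/2) ^ (length s + 2) * prob (X - U s))" for X s
  have F: "(1/2) ^ F X s \<le> (1/2) ^ (length s + 2) * prob (X - U s)" if "prob (X - U s) > 0" for X s
    unfolding F_def
  proof (rule someI_ex)
    have "0 < (1/2) ^ (length s + 2) * prob (X - U s)"
      using that by simp
    then obtain k where "(1/2) ^ k < (1/2) ^ (length s + 2) * prob (X - U s)"
      using real_arch_pow_inv[of "(1/2) ^ (length s + 2) * prob (X - U s)" "1/2"] by auto
    then show "\<exists>k. (1/2) ^ k \<le> (1/2) ^ (length s + 2) * prob (X - U s)"
      by (meson less_imp_le)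
  qed
  obtain g where g: "\<And>r. r \<in> R \<Longrightarrow> finite {s. g s < F (snd r) s}"
    using b_small_dominated_countable[OF small, of "\<lambda>r. F (snd r)"] by blast
  \<comment> \<open>The maximum with \<open>F UNIV\<close> makes \<open>UNIV\<close> obey the bound
    from stage 0 on, so that the complement of all \<open>W n\<close> has positive measure.\<close>
  define g' where "g' s = max (g s) (F UNIV s)" for s
  define pre where "pre = rec_nat [] (\<lambda>_ s. s @ [g' s])"
  have pre_0: "pre 0 = []" and pre_Suc: "pre (Suc n) = pre n @ [g' (pre n)]" for n
    by (simp_all add: pre_def)
  have len: "length (pre n) = n" for n
    by (induction n) (simp_all add: pre_0 pre_Suc)
  define W where "W n = U (pre n)" for n
  have W_0: "W 0 = {}"
    by (simp add: W_def U_def pre_0)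
  have W_Suc: "W (Suc n) = W n \<union> V n (g' (pre n))" for n
  proof -
    have "(\<Union>i<n. V i (pre (Suc n) ! i)) = (\<Union>i<n. V i (pre n ! i))"
      by (simp add: pre_Suc nth_append len)
    moreover have "pre (Suc n) ! n = g' (pre n)"
      by (simp add: pre_Suc nth_append len)
    ultimately show ?thesis
      by (simp add: W_def U_def len lessThan_Suc Un_commute)
  qed
  have incW: "incseq W"
    by (rule incseq_SucI) (simp add: W_Suc)
  have fd_W: "finitely_determined (W n)" for n
    unfolding W_def by (rule fd_U)
  have W_sets: "W n \<in> events" and V_sets: "V i k \<in> events" for n i k
    using fd_W V(1) by (auto intro: finitely_determined_measurable)
  \<comment> \<open>If the bound for \<open>X\<close> is obeyed from stage \<open>m\<close> on, at
    least half of \<open>X - W m\<close> survives all later stages.\<close>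
  have bound: "prob (X - (\<Union>n. W n)) > 0"
    if X: "X \<in> events" and dom: "\<And>n. m \<le> n \<Longrightarrow> F X (pre n) \<le> g' (pre n)"
      and pos: "prob (X - W m) > 0" for X m
  proof -
    define c where "c = prob (X - W m)"
    \<comment> \<open>Stage \<open>n\<close> removes at most c / 2^(n+2), which is exactly the drop
      of the bracket from \<open>n\<close> to \<open>Suc n\<close>.\<close>
    have lower: "c * (1/2 + (1/2) ^ Suc n) \<le> prob (X - W n)" if "m \<le> n" for n
      using that
    proof (induction n rule: dec_induct)
      case base
      have "(1/2) ^ Suc m \<le> (1/2 :: real)"
        by (simp add: power_le_one)
      then have "c * (1/2 + (1/2) ^ Suc m) \<le> c * 1"
        using pos by (intro mult_left_mono) (auto simp: c_def)
      then show ?case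
        by (simp add: c_def)
    next
      case (step n)
      have "0 < c * (1/2 + (1/2) ^ Suc n)"
        using pos by (intro mult_pos_pos add_pos_pos) (auto simp: c_def)
      then have pn: "prob (X - U (pre n)) > 0"
        using step.IH by (simp add: W_def)
      have "prob (V n (g' (pre n))) \<le> (1/2) ^ g' (pre n)"
        by (rule V)
      also have "\<dots> \<le> (1/2) ^ F X (pre n)"
        using dom[OF step.hyps(1)] by (intro power_decreasing) auto
      also have "\<dots> \<le> (1/2) ^ (n + 2) * prob (X - W n)"
        using F[OF pn] by (simp add: len W_def)
      also have "\<dots> \<le> (1/2) ^ (n + 2) * c"
        unfolding c_def using X W_sets incseqD[OF incW step.hyps(1)]
        by (intro mult_left_mono finite_measure_mono) auto
      finally have small: "prob (V n (g' (pre n))) \<le> (1/2) ^ (n + 2) * c" .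
      have "prob (X - W n) \<le> prob ((X - W (Suc n)) \<union> V n (g' (pre n)))"
        using X W_sets V_sets by (intro finite_measure_mono) (auto simp: W_Suc)
      also have "\<dots> \<le> prob (X - W (Suc n)) + prob (V n (g' (pre n)))"
        using X W_sets V_sets by (intro measure_Un_le) auto
      finally have "c * (1/2 + (1/2) ^ Suc n) - (1/2) ^ (n + 2) * c \<le> prob (X - W (Suc n))"
        using step.IH small by linarith
      then show ?case
        by (simp add: algebra_simps)
    qed
    have "(\<lambda>n. prob (X - W n)) \<longlonglongrightarrow> prob (\<Inter>n. X - W n)"
    proof (rule finite_Lim_measure_decseq)
      show "range (\<lambda>n. X - W n) \<subseteq> events"
        using X W_sets by auto
      show "decseq (\<lambda>n. X - W n)"
        using incW by (fastforce simp: decseq_def incseq_def)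
    qed
    moreover have "\<exists>n0. \<forall>n\<ge>n0. c / 2 \<le> prob (X - W n)"
    proof (intro exI allI impI)
      fix n assume "m \<le> n"
      have "c / 2 \<le> c * (1/2 + (1/2) ^ Suc n)"
        using pos by (simp add: c_def algebra_simps)
      then show "c / 2 \<le> prob (X - W n)"
        using lower[OF \<open>m \<le> n\<close>] by linarith
    qed
    ultimately have "c / 2 \<le> prob (\<Inter>n. X - W n)"
      by (rule LIMSEQ_le_const)
    moreover have "(\<Inter>n. X - W n) = X - (\<Union>n. W n)"
      by auto
    ultimately show ?thesis
      using pos by (simp add: c_def)
  qed
  have "prob (- (\<Union>n. W n)) > 0"
    using bound[of UNIV 0] sets.top[of cantor_measure] by (simp add: W_0 g'_def Compl_eq_Diff_UNIV prob_space[simplified])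
  moreover have "(\<Union>i. E i) \<subseteq> (\<Union>n. W n)"
  proof clarify
    fix x i assume "x \<in> E i"
    then have "x \<in> W (Suc i)"
      using V(2) by (auto simp: W_Suc)
    then show "x \<in> (\<Union>n. W n)"
      by blast
  qed
  moreover have "prob (X - (\<Union>n. W n)) > 0" if R: "(A, X) \<in> R" and pos: "\<And>n. prob (X - W n) > 0" for A X
  proof -
    \<comment> \<open>The sequences \<open>pre n\<close> have distinct lengths, so finitely many
      exceptional sequences affect only finitely many stages.\<close>
    have "pre -` {s. g s < F X s} = {n. g (pre n) < F X (pre n)}"
      by auto
    moreover have "inj pre"
      by (metis injI len)
    ultimately have "finite {n. g (pre n) < F X (pre n)}"
      using finite_vimageI[OF g[OF R], of pre] by simp
    then obtain m where "\<And>n. g (pre n) < F X (pre n) \<Longrightarrow> n < m"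
      unfolding finite_nat_set_iff_bounded by auto
    then have dom: "F X (pre n) \<le> g' (pre n)" if "m \<le> n" for n
      using that unfolding g'_def by (meson leD le_max_iff_disj not_le)
    show ?thesis
      using R meas by (intro bound[OF _ dom pos]) auto
  qed
  ultimately show ?thesis
    using incW fd_W by (intro exI[of _ W]) auto
qed

text \<open>\<open>C\<close> is the complement of the union of the \<open>W n\<close>. It suffices
  that \<open>A \<inter> B\<close> is finite iff \<open>X \<inter> C\<close> is null, and
  \<open>A - B\<close> is finite iff \<open>X - C\<close> is null, because every adjoined pair
  splits along \<open>B\<close> and \<open>C\<close>.\<close>

lemma faithful_adjoin_exists:
  fixes E :: "nat \<Rightarrow> (nat \<Rightarrow> bool) set"
  assumes alg: "pair_algebra R" and faith: "faithful R" and base: "base_pairs \<subseteq> R"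
    and small: "b_small R"
    and closed: "\<And>i. closed (E i)" and null: "\<And>i. emeasure cantor_measure (E i) = 0"
  shows "\<exists>B C W. faithful (adjoin R B C) \<and> measure cantor_measure C > 0 \<and>
    (\<forall>n. finitely_determined (W n)) \<and> (\<Union>i. E i) \<subseteq> (\<Union>n::nat. W n) \<and>
    (\<forall>n. finite (B \<inter> dense_trace (W n)))"
proof -
  interpret prob_space cantor_measure by (rule prob_space_cantor_measure)
  have meas: "X \<in> events" and fin: "finite A \<longleftrightarrow> prob X = 0" if "(A, X) \<in> R" for A X
    using faith that by (auto simp: faithful_def)
  have snd_R: "snd ` R \<subseteq> events"
    using meas by auto
  obtain W :: "nat \<Rightarrow> (nat \<Rightarrow> bool) set" where incW: "incseq W"
    and fdW: "\<And>n. finitely_determined (W n)" and EW: "(\<Union>i. E i) \<subseteq> (\<Union>n. W n)"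
    and Wpos: "prob (- (\<Union>n. W n)) > 0"
    and fat: "\<And>A X. (A, X) \<in> R \<Longrightarrow> (\<And>n. prob (X - W n) > 0) \<Longrightarrow> prob (X - (\<Union>n. W n)) > 0"
    using fat_closed_set_exists[of R E, OF small closed null snd_R] by blast
  define t where "t n = dense_trace (W n)" for n
  have tR: "(t n, W n) \<in> R" for n
    using trace_base_pairs[OF fdW] base by (auto simp: t_def)
  have t_mono: "t i \<subseteq> t n" if "i \<le> n" for i n
    unfolding t_def by (intro dense_trace_mono incseqD[OF incW that])
  define C where "C = - (\<Union>n. W n)"
  have W_sets: "W n \<in> events" for n
    using fdW by (rule finitely_determined_measurable)
  then have C_sets: "C \<in> events"
    unfolding C_def Compl_eq_Diff_UNIV using sets.top[of cantor_measure] by (intro sets.Diff) auto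
  \<comment> \<open>\<open>a A n\<close> is a candidate element of \<open>A \<inter> B\<close>;
    being larger than \<open>n\<close>, such elements are unbounded.\<close>
  define a where "a A n = (SOME k. k \<in> A - t n \<and> n < k)" for A n
  have a: "a A n \<in> A - t n" "n < a A n" if "infinite (A - t n)" for A n
  proof -
    have "\<exists>k. k \<in> A - t n \<and> n < k"
      using that by (auto simp: infinite_nat_iff_unbounded)
    then have "a A n \<in> A - t n \<and> n < a A n"
      unfolding a_def by (rule someI_ex)
    then show "a A n \<in> A - t n" "n < a A n"
      by auto
  qed
  define h where "h A n = (\<Sum>i\<le>n. Suc (a A i)) + (\<Sum>k\<in>A \<inter> t n. Suc k)" for A n
  obtain g where g: "\<And>A X. (A, X) \<in> R \<Longrightarrow> \<forall>\<^sub>F n in sequentially. h A n \<le> g n"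
    using b_small_dominated[OF small, of "\<lambda>r. h (fst r)"] by fastforce
  \<comment> \<open>The first sum in \<open>h\<close> keeps \<open>B\<close> meeting every \<open>A\<close> not almost covered by some \<open>t n\<close>;
    the second keeps \<open>A - B\<close> finite for every \<open>A\<close> almost disjoint from all \<open>t n\<close>.\<close>
  define B where "B = {k. \<forall>n. k \<in> t n \<longrightarrow> k < g n}"
  have B_t: "finite (B \<inter> t n)" for n
    by (rule finite_subset[of _ "{..<g n}"]) (auto simp: B_def)
  have inside: "finite (A \<inter> B) \<longleftrightarrow> prob (X \<inter> C) = 0" if R: "(A, X) \<in> R" for A X
  proof
    assume "prob (X \<inter> C) = 0"
    then have "\<not> prob (X - (\<Union>n. W n)) > 0"
      by (simp add: C_def Diff_eq)
    \<comment> \<open>\<open>fat\<close> read backwards: if \<open>X\<close> is null on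
      \<open>C\<close>, some single \<open>W n\<close> already contains almost all of
      \<open>X\<close>.\<close>
    then obtain n where "\<not> prob (X - W n) > 0"
      using fat[OF R] by blast
    then have "finite (A - t n)"
      using fin[OF pair_algebra_Diff[OF alg R tR]] by (simp add: zero_less_measure_iff)
    then have "finite ((A - t n) \<union> (B \<inter> t n))"
      using B_t by blast
    then show "finite (A \<inter> B)"
      by (rule rev_finite_subset) auto
  next
    assume finAB: "finite (A \<inter> B)"
    show "prob (X \<inter> C) = 0"
    proof (rule ccontr)
      assume "prob (X \<inter> C) \<noteq> 0"
      moreover have "prob (X \<inter> C) \<le> prob (X - W n)" for n
        using meas[OF R] W_sets by (intro finite_measure_mono) (auto simp: C_def)
      ultimately have "prob (X - W n) \<noteq> 0" for n
        by (metis measure_le_0_iff)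
      then have inf: "infinite (A - t n)" for n
        using fin[OF pair_algebra_Diff[OF alg R tR]] by blast
      obtain m where m: "\<And>n. m \<le> n \<Longrightarrow> h A n \<le> g n"
        using g[OF R] unfolding eventually_sequentially by blast
      have aB: "a A n \<in> A \<inter> B" if "m \<le> n" for n
      proof -
        have "a A n < g i" if i: "a A n \<in> t i" for i
        proof -
          \<comment> \<open>The sets \<open>t i\<close> increase and \<open>a A n\<close> avoids
            \<open>t n\<close>; hence \<open>a A n\<close> occurs in the sum that defines
            \<open>h A i\<close>, which \<open>g i\<close> bounds.\<close>
          have "n < i"
            using a(1)[OF inf[of n]] t_mono[of i n] i by (meson DiffD2 not_le subsetD)
          then have "Suc (a A n) \<le> (\<Sum>i\<le>i. Suc (a A i))"
            by (intro member_le_sum[of _ _ "\<lambda>i. Suc (a A i)"]) auto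
          also have "\<dots> \<le> g i"
            using m[of i] \<open>n < i\<close> \<open>m \<le> n\<close> by (simp add: h_def)
          finally show ?thesis by simp
        qed
        then show ?thesis
          using a(1)[OF inf[of n]] by (auto simp: B_def)
      qed
      have "infinite (A \<inter> B)"
        unfolding infinite_nat_iff_unbounded
      proof
        fix k
        show "\<exists>n>k. n \<in> A \<inter> B"
          using aB[of "max m k"] a(2)[OF inf[of "max m k"]] by (meson max.cobounded1 max.cobounded2 le_less_trans)
      qed
      then show False
        using finAB by blast
    qed
  qed
  have outside: "finite (A - B) \<longleftrightarrow> prob (X - C) = 0" if R: "(A, X) \<in> R" for A X
  proof -
    \<comment> \<open>Both sides reduce to the pieces: \<open>A \<inter> t n\<close> is finite iff
      \<open>X \<inter> W n\<close> is null, and countably many null pieces have a null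
      union.\<close>
    have "finite (A - B) \<longleftrightarrow> (\<forall>n. finite (A \<inter> t n))"
    proof (intro iffI allI)
      fix n assume "finite (A - B)"
      then have "finite ((A - B) \<union> (B \<inter> t n))"
        using B_t by blast
      then show "finite (A \<inter> t n)"
        by (rule rev_finite_subset) auto
    next
      assume finA: "\<forall>n. finite (A \<inter> t n)"
      obtain m where m: "\<And>n. m \<le> n \<Longrightarrow> h A n \<le> g n"
        using g[OF R] unfolding eventually_sequentially by blast
      \<comment> \<open>A point of \<open>A - B\<close> lies in some \<open>t n\<close> but is at
        least \<open>g n\<close>. The second sum in \<open>h A n\<close> exceeds that point, so
        domination fails at \<open>n\<close>, which forces \<open>n < m\<close>.\<close>
      have "A - B \<subseteq> (\<Union>n<m. A \<inter> t n)"
      proof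
        fix k assume k: "k \<in> A - B"
        then obtain n where n: "k \<in> t n" "g n \<le> k"
          by (auto simp: B_def not_less)
        have "Suc k \<le> (\<Sum>k\<in>A \<inter> t n. Suc k)"
          using k n finA by (intro member_le_sum) auto
        then have "k < h A n"
          by (simp add: h_def)
        then have "n < m"
          using m[of n] n by (meson leD le_trans not_le)
        then show "k \<in> (\<Union>n<m. A \<inter> t n)"
          using k n by blast
      qed
      then show "finite (A - B)"
        by (rule finite_subset) (use finA in \<open>blast intro: finite_UN_I\<close>)
    qed
    also have "\<dots> \<longleftrightarrow> (\<forall>n. prob (X \<inter> W n) = 0)"
      using fin[OF pair_algebra_Int[OF alg R tR]] by simp
    also have "\<dots> \<longleftrightarrow> prob (X - C) = 0"
    proof
      assume "\<forall>n. prob (X \<inter> W n) = 0"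
      then have "X \<inter> W n \<in> null_sets cantor_measure" for n
        using meas[OF R] W_sets by (auto simp: null_sets_def emeasure_eq_measure)
      then have "(\<Union>n. X \<inter> W n) \<in> null_sets cantor_measure"
        by (rule null_sets_UN)
      moreover have "X - C = (\<Union>n. X \<inter> W n)"
        by (auto simp: C_def)
      ultimately show "prob (X - C) = 0"
        by (simp add: measure_eq_0_null_sets)
    next
      assume X0: "prob (X - C) = 0"
      show "\<forall>n. prob (X \<inter> W n) = 0"
      proof
        fix n
        have "prob (X \<inter> W n) \<le> prob (X - C)"
          using meas[OF R] C_sets by (intro finite_measure_mono) (auto simp: C_def)
        then show "prob (X \<inter> W n) = 0"
          using X0 by (simp add: measure_le_0_iff)
      qed
    qed
    finally show ?thesis .
  qed
  have "faithful (adjoin R B C)"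
    unfolding faithful_def
  proof (intro allI impI)
    fix D Y assume "(D, Y) \<in> adjoin R B C"
    then obtain A X A' X' where *: "(A, X) \<in> R" "(A', X') \<in> R"
      "D = (A \<inter> B) \<union> (A' - B)" "Y = (X \<inter> C) \<union> (X' - C)"
      by (rule adjoinE)
    have sets: "X \<inter> C \<in> events" "X' - C \<in> events"
      using meas * C_sets by blast+
    have "prob Y = prob (X \<inter> C) + prob (X' - C)"
      unfolding *(4) by (rule finite_measure_Union[OF sets]) auto
    then have "prob Y = 0 \<longleftrightarrow> prob (X \<inter> C) = 0 \<and> prob (X' - C) = 0"
      by (simp add: add_nonneg_eq_0_iff)
    also have "\<dots> \<longleftrightarrow> finite D"
      unfolding *(3) using inside[OF *(1)] outside[OF *(2)] by simp
    finally show "Y \<in> events \<and> (finite D \<longleftrightarrow> prob Y = 0)"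
      using sets *(4) by blast
  qed
  then show ?thesis
    using Wpos fdW EW B_t unfolding C_def t_def by blast
qed

subsection \<open>Transfinite construction\<close>

text \<open>\<open>B\<close> is an infinite set that is almost disjoint from the trace of every clopen piece of a
  neighbourhood of \<open>Z\<close>; hence no ultrafilter lying over a point of \<open>Z\<close> and omitting the finite sets
  contains \<open>B\<close>.\<close>
definition evades :: "(nat set \<times> (nat \<Rightarrow> bool) set) set \<Rightarrow> (nat \<Rightarrow> bool) set \<Rightarrow> bool" where
  "evades R Z \<longleftrightarrow> (\<exists>B C W. (B, C) \<in> R \<and> measure cantor_measure C > 0 \<and>
    (\<forall>n. finitely_determined (W n)) \<and> Z \<subseteq> (\<Union>n::nat. W n) \<and>
    (\<forall>n. finite (B \<inter> dense_trace (W n))))"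

lemma evades_mono: "evades R Z \<Longrightarrow> R \<subseteq> R' \<Longrightarrow> evades R' Z"
  unfolding evades_def by blast

lemma evades_subset: "evades R Z \<Longrightarrow> Z' \<subseteq> Z \<Longrightarrow> evades R Z'"
  unfolding evades_def by (meson subset_trans)

lemma countable_card_le_infinite:
  assumes "countable A" "infinite I"
  shows "|A| \<le>o |I|"
proof -
  have "|A| \<le>o |UNIV :: nat set|"
    using assms(1) unfolding countable_def card_of_ordLeq[symmetric] by auto
  also have "|UNIV :: nat set| \<le>o |I|"
    using assms(2) by (simp add: infinite_iff_card_of_nat)
  finally (ordLeq_transitive) show ?thesis .
qed

lemma card_adjoin_le:
  assumes "|R| \<le>o |I|" "infinite I"
  shows "|adjoin R B C| \<le>o |I|"
proof -
  have "|adjoin R B C| \<le>o |R \<times> R|"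
    unfolding adjoin_def by (rule card_of_image)
  also have "|R \<times> R| \<le>o |I|"
    by (rule card_of_Sigma_ordLeq_infinite) (use assms in auto)
  finally (ordLeq_transitive) show ?thesis .
qed

text \<open>Transfinite recursion along \<open>J\<close>, adjoining one pair for each
  \<open>j\<close>. Each stage stays countable or smaller than \<open>J\<close>, hence
  \<open>b_small\<close>, and unions of increasing stages remain faithful.\<close>

lemma faithful_algebra_exists:
  fixes J :: "'j set" and E :: "'j \<Rightarrow> nat \<Rightarrow> (nat \<Rightarrow> bool) set"
  assumes J: "\<And>B. unbounded_family B \<Longrightarrow> |J| \<le>o |B|"
    and closed: "\<And>j i. j \<in> J \<Longrightarrow> closed (E j i)"
    and null: "\<And>j i. j \<in> J \<Longrightarrow> emeasure cantor_measure (E j i) = 0"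
  shows "\<exists>R. pair_algebra R \<and> faithful R \<and> base_pairs \<subseteq> R \<and> (\<forall>j\<in>J. evades R (\<Union>i. E j i))"
proof -
  \<comment> \<open>A well-order of least type, so that every proper initial segment has fewer
    elements than \<open>J\<close>.\<close>
  define r where "r = |J|"
  have wo: "Well_order r" and fld: "Field r = J"
    unfolding r_def by (rule card_of_Well_order, rule Field_card_of)
  interpret r: wo_rel r
    by unfold_locales (rule wo)
  define S where "S f j = base_pairs \<union> (\<Union>i\<in>underS r j. f i)" for f :: "'j \<Rightarrow> _" and j
  \<comment> \<open>The recursion invariant. The countable alternative covers finite initial
    segments; outside \<open>J\<close> nothing is demanded, so that \<open>f\<close> can be
    total.\<close>
  define P where "P f j T \<longleftrightarrow> (j \<in> J \<longrightarrow> S f j \<subseteq> T \<and> pair_algebra T \<and> faithful T \<and>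
      (countable T \<or> |T| \<le>o |underS r j| ) \<and> evades T (\<Union>i. E j i))" for f j T
  have mono: "f i \<subseteq> f j" if "i \<in> underS r j" "P f j (f j)" "j \<in> J" for f i j
    using that by (auto simp: P_def S_def)
  have underS_J: "i \<in> J" if "i \<in> underS r j" for i j
    using that underS_Field fld by fast
  have comparable: "i = j \<or> i \<in> underS r j \<or> j \<in> underS r i" if "i \<in> J" "j \<in> J" for i j
    using that r.TOTAL fld by (auto simp: total_on_def underS_def)
  \<comment> \<open>Used for initial segments during the recursion and for all of \<open>J\<close>
    at the end. Stages increase along \<open>r\<close>, hence form a chain.\<close>
  have union: "pair_algebra (base_pairs \<union> (\<Union>i\<in>I. f i)) \<and> faithful (base_pairs \<union> (\<Union>i\<in>I. f i))"
    if I: "I \<subseteq> J" and P: "\<And>i. i \<in> I \<Longrightarrow> P f i (f i)" for f I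
  proof
    let ?\<S> = "insert base_pairs (f ` I)"
    have eq: "base_pairs \<union> (\<Union>i\<in>I. f i) = \<Union>?\<S>"
      by simp
    have "pair_algebra (\<Union>?\<S>)"
    proof (rule pair_algebra_Union)
      show "pair_algebra R" if "R \<in> ?\<S>" for R
        using that I P pair_algebra_base_pairs by (auto simp: P_def)
      show "R \<subseteq> R' \<or> R' \<subseteq> R" if RR: "R \<in> ?\<S>" "R' \<in> ?\<S>" for R R'
      proof -
        have "base_pairs \<subseteq> f i" if "i \<in> I" for i
          using P[OF that] I that by (auto simp: P_def S_def)
        moreover have "f i \<subseteq> f j \<or> f j \<subseteq> f i" if ij: "i \<in> I" "j \<in> I" for i j
          using comparable[of i j] mono[of i j f] mono[of j i f] P[OF ij(1)] P[OF ij(2)] I ij by blast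
        ultimately show ?thesis
          using RR by blast
      qed
    qed simp
    then show "pair_algebra (base_pairs \<union> (\<Union>i\<in>I. f i))"
      by (simp only: eq)
    show "faithful (base_pairs \<union> (\<Union>i\<in>I. f i))"
      using I P faithful_base_pairs unfolding faithful_def P_def by blast
  qed
  have "\<exists>f. \<forall>j. P f j (f j)"
  proof (rule dependent_wf_choice)
    show "wf (r - Id)"
      by (rule r.WF)
    \<comment> \<open>Well-founded choice requires that the invariant at \<open>j\<close> depends
      only on the values of \<open>f\<close> strictly below \<open>j\<close>.\<close>
    show "P f j T = P g j T" if "\<And>i. (i, j) \<in> r - Id \<Longrightarrow> f i = g i" for f g j T
    proof -
      have "S f j = S g j"
        using that by (auto simp: S_def underS_def)
      then show ?thesis
        by (simp add: P_def)
    qed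
    show "\<exists>T. P f j T" if IH: "\<And>i. (i, j) \<in> r - Id \<Longrightarrow> P f i (f i)" for f j
    proof (cases "j \<in> J")
      case j: True
      have P: "P f i (f i)" if "i \<in> underS r j" for i
        using that IH by (auto simp: underS_def)
      have alg: "pair_algebra (S f j)" and faith: "faithful (S f j)"
        using union[of "underS r j" f] P underS_J by (auto simp: S_def)
      have size_f: "countable (f i) \<or> |f i| \<le>o |underS r j|" if i: "i \<in> underS r j" for i
      proof -
        have "underS r i \<subseteq> underS r j"
          using i r.TRANS r.ANTISYM by (auto simp: underS_def trans_def antisym_def)
        then show ?thesis
          using P[OF i] underS_J[OF i] by (metis P_def card_of_mono1 ordLeq_transitive)
      qed
      \<comment> \<open>Infinity of the segment is recorded because only then does adjoining a pair
        keep the cardinality bound.\<close>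
      have size: "countable (S f j) \<or> infinite (underS r j) \<and> |S f j| \<le>o |underS r j|"
      proof (cases "finite (underS r j)")
        case True
        have "countable (f i)" if "i \<in> underS r j" for i
          using size_f[OF that] True card_of_ordLeq_finite countable_finite by blast
        then show ?thesis
          using True countable_base_pairs by (auto simp: S_def intro: countable_finite)
      next
        case False
        then have "|f i| \<le>o |underS r j|" if "i \<in> underS r j" for i
          using size_f[OF that] countable_card_le_infinite by blast
        then have "|\<Union>i\<in>underS r j. f i| \<le>o |underS r j|"
          using False card_of_mono1[OF order_refl] by (intro card_of_UNION_ordLeq_infinite) auto
        moreover have "S f j = (\<Union>i\<in>underS r j. f i)"
        proof -
          obtain i where "i \<in> underS r j"
            using False by fastforce
          then show ?thesis
            using P[of i] underS_J[of i] by (auto simp: P_def S_def)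
        qed
        ultimately have "|S f j| \<le>o |underS r j|"
          by simp
        then show ?thesis
          using False by blast
      qed
      have "|underS r j| <o |J|"
        unfolding r_def using card_of_underS[OF card_of_Card_order, of j J] j by (simp add: Field_card_of)
      then have small: "b_small (S f j)"
        using size b_small_countable b_small_ordLess[OF J] ordLeq_ordLess_trans by blast
      obtain B C W where ext: "faithful (adjoin (S f j) B C)" "measure cantor_measure C > 0"
        "\<And>n. finitely_determined (W n)" "(\<Union>i. E j i) \<subseteq> (\<Union>n::nat. W n)"
        "\<And>n. finite (B \<inter> dense_trace (W n))"
        using faithful_adjoin_exists[of "S f j" "E j", OF alg faith _ small closed[OF j] null[OF j]]
        by (auto simp: S_def)
      have "countable (adjoin (S f j) B C) \<or> |adjoin (S f j) B C| \<le>o |underS r j|"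
        using size card_adjoin_le[of "S f j" "underS r j" B C] by (auto simp: adjoin_def)
      moreover have "evades (adjoin (S f j) B C) (\<Union>i. E j i)"
        unfolding evades_def using ext mem_adjoin[OF alg] by blast
      ultimately have "P f j (adjoin (S f j) B C)"
        unfolding P_def using ext(1) subset_adjoin[of "S f j" B C] pair_algebra_adjoin[OF alg, of B C]
        by simp
      then show ?thesis ..
    qed (simp add: P_def)
  qed
  then obtain f where "\<forall>j. P f j (f j)"
    by (rule exE)
  then have f: "P f j (f j)" for j
    by simp
  let ?R = "base_pairs \<union> (\<Union>j\<in>J. f j)"
  have "evades ?R (\<Union>i. E j i)" if "j \<in> J" for j
  proof (rule evades_mono)
    show "evades (f j) (\<Union>i. E j i)"
      using f[of j] that by (simp add: P_def)
    show "f j \<subseteq> ?R"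
      using that by blast
  qed
  then show ?thesis
    using union[of J f, OF order_refl f] by (intro exI[of _ ?R]) simp
qed

subsection \<open>Regular Borel extension of a content on clopen sets\<close>

locale clopen_content =
  fixes T :: "'a topology" and \<C> :: "'a set set" and m :: "'a set \<Rightarrow> ennreal"
  assumes compact: "compact_space T"
    and openC: "C \<in> \<C> \<Longrightarrow> openin T C"
    and base: "openin T U \<Longrightarrow> x \<in> U \<Longrightarrow> \<exists>C\<in>\<C>. x \<in> C \<and> C \<subseteq> U"
    and emptyC: "{} \<in> \<C>"
    and topC: "topspace T \<in> \<C>"
    and UnC: "C \<in> \<C> \<Longrightarrow> D \<in> \<C> \<Longrightarrow> C \<union> D \<in> \<C>"
    and DiffC: "C \<in> \<C> \<Longrightarrow> D \<in> \<C> \<Longrightarrow> C - D \<in> \<C>"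
    and m_empty: "m {} = 0"
    and m_Un: "C \<in> \<C> \<Longrightarrow> D \<in> \<C> \<Longrightarrow> C \<inter> D = {} \<Longrightarrow> m (C \<union> D) = m C + m D"
    and m_top: "m (topspace T) = 1"
begin

text \<open>The intended measure of an open set. The function \<open>outer\<close> then approximates
  arbitrary sets by open ones, which builds outer regularity in.\<close>

definition inner :: "'a set \<Rightarrow> ennreal" where
  "inner U = (SUP C\<in>{C\<in>\<C>. C \<subseteq> U}. m C)"

definition outer :: "'a set \<Rightarrow> ennreal" where
  "outer A = (INF U\<in>{U. openin T U \<and> A \<subseteq> U}. inner U)"

lemma C_subset: "C \<in> \<C> \<Longrightarrow> C \<subseteq> topspace T"
  using openC openin_subset by blast

lemma closedC: "C \<in> \<C> \<Longrightarrow> closedin T C"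
  using openC[OF DiffC[OF topC]] C_subset by (simp add: closedin_def)

lemma m_mono:
  assumes "C \<in> \<C>" "D \<in> \<C>" "C \<subseteq> D"
  shows "m C \<le> m D"
proof -
  have "m D = m (C \<union> (D - C))"
    using assms by (metis Un_Diff_cancel Un_absorb1)
  also have "\<dots> = m C + m (D - C)"
    by (rule m_Un) (use assms DiffC in auto)
  finally show ?thesis
    by simp
qed

lemma m_Un_le:
  assumes "C \<in> \<C>" "D \<in> \<C>"
  shows "m (C \<union> D) \<le> m C + m D"
proof -
  have "m (C \<union> D) = m (C \<union> (D - C))"
    by simp
  also have "\<dots> = m C + m (D - C)"
    by (rule m_Un) (use assms DiffC in auto)
  also have "\<dots> \<le> m C + m D"
    by (intro add_left_mono m_mono) (use assms DiffC in auto)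
  finally show ?thesis .
qed

lemma UN_C: "finite I \<Longrightarrow> (\<And>i. i \<in> I \<Longrightarrow> D i \<in> \<C>) \<Longrightarrow> (\<Union>i\<in>I. D i) \<in> \<C>"
  by (induction I rule: finite_induct) (auto intro: emptyC UnC)

lemma m_UN_le:
  "finite I \<Longrightarrow> (\<And>i. i \<in> I \<Longrightarrow> D i \<in> \<C>) \<Longrightarrow> m (\<Union>i\<in>I. D i) \<le> (\<Sum>i\<in>I. m (D i))"
proof (induction I rule: finite_induct)
  case empty
  then show ?case by (simp add: m_empty)
next
  case (insert i I)
  have "m (D i \<union> (\<Union>i\<in>I. D i)) \<le> m (D i) + m (\<Union>i\<in>I. D i)"
    by (rule m_Un_le) (use insert UN_C in auto)
  also have "\<dots> \<le> m (D i) + (\<Sum>i\<in>I. m (D i))"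
    using insert by (intro add_left_mono) auto
  finally show ?case
    using insert by simp
qed

lemma m_le_inner: "C \<in> \<C> \<Longrightarrow> C \<subseteq> U \<Longrightarrow> m C \<le> inner U"
  unfolding inner_def by (rule SUP_upper) simp

lemma inner_le: "(\<And>C. C \<in> \<C> \<Longrightarrow> C \<subseteq> U \<Longrightarrow> m C \<le> z) \<Longrightarrow> inner U \<le> z"
  unfolding inner_def by (rule SUP_least) simp

lemma inner_mono: "U \<subseteq> V \<Longrightarrow> inner U \<le> inner V"
  by (rule inner_le, rule m_le_inner) auto

lemma inner_empty: "inner {} = 0"
  using inner_le[of "{}" 0] by (simp add: m_empty)

lemma inner_topspace: "inner (topspace T) = 1"
  using inner_le[of "topspace T" 1] m_le_inner[OF topC subset_refl] m_mono[OF _ topC]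
  by (auto simp: m_top intro!: antisym)

text \<open>Compactness turns finite additivity into countable subadditivity: a clopen set inside
  the union is covered by finitely many clopen sets, each inside some \<open>U i\<close>.\<close>

lemma inner_UN_le:
  fixes U :: "nat \<Rightarrow> 'a set"
  assumes U: "\<And>i. openin T (U i)"
  shows "inner (\<Union>i. U i) \<le> (\<Sum>i. inner (U i))"
proof (rule inner_le)
  fix C assume C: "C \<in> \<C>" "C \<subseteq> (\<Union>i. U i)"
  have "compactin T C"
    using C closedC closedin_compact_space compact by blast
  moreover have "\<And>D. D \<in> {D\<in>\<C>. \<exists>i. D \<subseteq> U i} \<Longrightarrow> openin T D"
    using openC by blast
  moreover have "C \<subseteq> \<Union>{D\<in>\<C>. \<exists>i. D \<subseteq> U i}"
  proof
    fix x assume "x \<in> C"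
    then obtain i where "x \<in> U i" using C by blast
    then show "x \<in> \<Union>{D\<in>\<C>. \<exists>i. D \<subseteq> U i}"
      using base[OF U[of i]] by blast
  qed
  ultimately obtain \<D> where \<D>: "finite \<D>" "\<D> \<subseteq> {D\<in>\<C>. \<exists>i. D \<subseteq> U i}" "C \<subseteq> \<Union>\<D>"
    using compactinD[of T C "{D\<in>\<C>. \<exists>i. D \<subseteq> U i}"] by blast
  then have "\<forall>D\<in>\<D>. \<exists>i. D \<subseteq> U i"
    by auto
  from bchoice[OF this] obtain ix where ix: "\<And>D. D \<in> \<D> \<Longrightarrow> D \<subseteq> U (ix D)"
    by auto
  \<comment> \<open>Pieces assigned to the same index are merged, so that each
    \<open>inner (U i)\<close> is counted once.\<close>
  define E where "E i = \<Union>{D\<in>\<D>. ix D = i}" for i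
  have EC: "E i \<in> \<C>" for i
    using UN_C[of "{D\<in>\<D>. ix D = i}" "\<lambda>D. D"] \<D> by (auto simp: E_def)
  have EU: "E i \<subseteq> U i" for i
    using ix by (auto simp: E_def)
  have "m C \<le> m (\<Union>i\<in>ix ` \<D>. E i)"
  proof (rule m_mono)
    show "(\<Union>i\<in>ix ` \<D>. E i) \<in> \<C>"
      using \<D> EC by (intro UN_C) auto
    show "C \<subseteq> (\<Union>i\<in>ix ` \<D>. E i)"
      using \<D>(3) unfolding E_def by blast
  qed (use C in auto)
  also have "\<dots> \<le> (\<Sum>i\<in>ix ` \<D>. m (E i))"
    using \<D> EC by (intro m_UN_le) auto
  also have "\<dots> \<le> (\<Sum>i\<in>ix ` \<D>. inner (U i))"
    using EC EU by (intro sum_mono m_le_inner)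
  also have "\<dots> \<le> (\<Sum>i. inner (U i))"
    using \<D> by (intro sum_le_suminf) auto
  finally show "m C \<le> (\<Sum>i. inner (U i))" .
qed

lemma outer_le: "openin T U \<Longrightarrow> A \<subseteq> U \<Longrightarrow> outer A \<le> inner U"
  unfolding outer_def by (rule INF_lower) simp

lemma outer_open: "openin T U \<Longrightarrow> outer U = inner U"
  by (intro antisym outer_le) (auto simp: outer_def intro!: INF_greatest inner_mono)

lemma outer_mono: "A \<subseteq> B \<Longrightarrow> outer A \<le> outer B"
  unfolding outer_def by (rule INF_superset_mono) auto

text \<open>An open superset of \<open>A n\<close> is chosen with error e / 2^(n+1); the errors add
  up to \<open>e\<close>.\<close>

lemma outer_UN_le:
  fixes A :: "nat \<Rightarrow> 'a set"
  shows "outer (\<Union>i. A i) \<le> (\<Sum>i. outer (A i))"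
proof (rule ennreal_le_epsilon)
  fix e :: real assume e: "0 < e" "(\<Sum>i. outer (A i)) < top"
  then have less: "outer (A n) < outer (A n) + e * (1/2) ^ Suc n" for n
    by (auto simp add: less_top dest!: ennreal_suminf_lessD)
  have "\<exists>U. openin T U \<and> A n \<subseteq> U \<and> inner U \<le> outer (A n) + e * (1/2) ^ Suc n" for n
    using less[of n, unfolded outer_def INF_less_iff] by (auto simp: outer_def intro: less_imp_le)
  then obtain U where U: "\<And>n. openin T (U n)" "\<And>n. A n \<subseteq> U n"
      "\<And>n. inner (U n) \<le> outer (A n) + e * (1/2) ^ Suc n"
    by metis
  have "outer (\<Union>i. A i) \<le> inner (\<Union>i. U i)"
    using U by (intro outer_le) blast+
  also have "\<dots> \<le> (\<Sum>i. inner (U i))"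
    using U by (intro inner_UN_le)
  also have "\<dots> \<le> (\<Sum>n. outer (A n) + e * (1/2) ^ Suc n)"
    using U by (intro suminf_le) auto
  also have "\<dots> = (\<Sum>n. outer (A n)) + (\<Sum>n. ennreal e * ennreal ((1/2) ^ Suc n))"
    using e by (subst suminf_add[symmetric])
      (auto simp del: ennreal_suminf_cmult simp add: ennreal_mult[symmetric])
  also have "\<dots> = (\<Sum>n. outer (A n)) + e"
    unfolding ennreal_suminf_cmult
    by (subst suminf_ennreal_eq[OF zero_le_power power_half_series]) auto
  finally show "outer (\<Union>i. A i) \<le> (\<Sum>i. outer (A i)) + ennreal e" .
qed

lemma outer_empty: "outer {} = 0"
  by (simp add: outer_open inner_empty)

text \<open>The nontrivial half of the Caratheodory condition for open sets; the other half is
  subadditivity.\<close>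

lemma outer_split_open:
  assumes U: "openin T U"
  shows "outer (A \<inter> U) + outer (A - U) \<le> outer A"
  unfolding outer_def[of A]
proof (rule INF_greatest, clarify)
  fix W assume W: "openin T W" "A \<subseteq> W"
  have bound: "m C + outer (W - U) \<le> inner W" if C: "C \<in> \<C>" "C \<subseteq> W \<inter> U" for C
  proof -
    \<comment> \<open>\<open>W - C\<close> is an open superset of \<open>W - U\<close>, and each
      clopen subset of it is disjoint from \<open>C\<close>, so contents add.\<close>
    have "openin T (W - C)"
      using W closedC[OF C(1)] by (simp add: openin_diff)
    then have "m C + outer (W - U) \<le> m C + inner (W - C)"
      using C by (intro add_left_mono outer_le) auto
    also have "\<dots> = (SUP D\<in>{D\<in>\<C>. D \<subseteq> W - C}. m C + m D)"
      unfolding inner_def using emptyC by (intro ennreal_SUP_add_right) auto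
    also have "\<dots> \<le> inner W"
    proof (rule SUP_least, clarify)
      fix D assume D: "D \<in> \<C>" "D \<subseteq> W - C"
      then have "m C + m D = m (C \<union> D)"
        using C by (intro m_Un[symmetric]) auto
      also have "\<dots> \<le> inner W"
        using C D UnC by (intro m_le_inner) auto
      finally show "m C + m D \<le> inner W" .
    qed
    finally show ?thesis .
  qed
  have "outer (A \<inter> U) + outer (A - U) \<le> inner (W \<inter> U) + outer (W - U)"
    using W U by (intro add_mono outer_le outer_mono) auto
  also have "\<dots> = (SUP C\<in>{C\<in>\<C>. C \<subseteq> W \<inter> U}. m C + outer (W - U))"
    unfolding inner_def using emptyC by (intro ennreal_SUP_add_left[symmetric]) auto
  also have "\<dots> \<le> inner W"
    using bound by (intro SUP_least) auto
  finally show "outer (A \<inter> U) + outer (A - U) \<le> inner W" .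
qed

definition extension :: "'a measure" where
  "extension = measure_of (topspace T) (sigma_sets (topspace T) {U. openin T U}) outer"

lemma opens_Pow: "{U. openin T U} \<subseteq> Pow (topspace T)"
  using openin_subset by blast

lemma outer_Un_le: "outer (A \<union> B) \<le> outer A + outer B"
proof -
  have "outer (A \<union> B) = outer (\<Union>i. binaryset A B i)"
    by (simp add: UN_binaryset_eq)
  also have "\<dots> \<le> (\<Sum>i. outer (binaryset A B i))"
    by (rule outer_UN_le)
  also have "\<dots> = outer A + outer B"
    by (rule suminf_binaryset_eq) (rule outer_empty)
  finally show ?thesis .
qed

text \<open>By Caratheodory's theorem \<open>outer\<close> is a measure on its measurable sets, a
  sigma-algebra that contains the open sets and hence all Borel sets.\<close>

lemma measure_space_outer:
  "measure_space (topspace T) (sigma_sets (topspace T) {U. openin T U}) outer"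
proof -
  interpret P: sigma_algebra "topspace T" "Pow (topspace T)"
    by (rule sigma_algebra_Pow)
  let ?L = "lambda_system (topspace T) (Pow (topspace T)) outer"
  have "outer_measure_space (Pow (topspace T)) outer"
    by (auto simp: outer_measure_space_def positive_def increasing_def countably_subadditive_def
        outer_empty outer_UN_le outer_mono)
  then have L: "measure_space (topspace T) ?L outer"
    by (rule P.caratheodory_lemma)
  have "{U. openin T U} \<subseteq> ?L"
  proof clarify
    fix U assume U: "openin T U"
    have "outer (U \<inter> A) + outer ((topspace T - U) \<inter> A) = outer A" if "A \<subseteq> topspace T" for A
    proof (rule antisym)
      have eq: "(topspace T - U) \<inter> A = A - U" "U \<inter> A = A \<inter> U"
        using that by auto
      then show "outer (U \<inter> A) + outer ((topspace T - U) \<inter> A) \<le> outer A"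
        using outer_split_open[OF U, of A] by simp
      show "outer A \<le> outer (U \<inter> A) + outer ((topspace T - U) \<inter> A)"
        using outer_Un_le[of "A \<inter> U" "A - U"] eq by (simp add: Int_Diff_Un)
    qed
    then show "U \<in> ?L"
      using U by (auto simp: lambda_system_def openin_subset)
  qed
  moreover have "sigma_algebra (topspace T) ?L"
    using L by (simp add: measure_space_def)
  ultimately have "sigma_sets (topspace T) {U. openin T U} \<subseteq> ?L"
    by (simp add: sigma_algebra.sigma_sets_subset)
  then show ?thesis
    using L measure_down sigma_algebra_sigma_sets[OF opens_Pow] by blast
qed

lemma space_extension: "space extension = topspace T"
  and sets_extension: "sets extension = sets (borel_of_top T)"
proof -
  have "sigma_sets (topspace T) {U. openin T U} \<subseteq> Pow (topspace T)"
    using sigma_sets_into_sp[OF opens_Pow] by blast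
  then show "space extension = topspace T" "sets extension = sets (borel_of_top T)"
    using opens_Pow
    by (simp_all add: extension_def borel_of_top_def space_measure_of_conv sets_measure_of_conv
        sigma_sets_sigma_sets_eq)
qed

lemma emeasure_extension:
  assumes "A \<in> sets extension"
  shows "emeasure extension A = outer A"
  unfolding extension_def
proof (rule emeasure_measure_of_sigma)
  show "A \<in> sigma_sets (topspace T) {U. openin T U}"
    using assms opens_Pow by (simp add: sets_extension borel_of_top_def)
qed (use measure_space_outer in \<open>simp_all add: measure_space_def\<close>)

lemma open_in_sets_extension: "openin T U \<Longrightarrow> U \<in> sets extension"
  using opens_Pow by (auto simp: sets_extension borel_of_top_def)

lemma emeasure_extension_open: "openin T U \<Longrightarrow> emeasure extension U = inner U"
  by (simp add: emeasure_extension open_in_sets_extension outer_open)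

text \<open>Outer regularity is the definition of \<open>outer\<close>; inner regularity follows by
  passing to complements.\<close>

lemma regular_extension: "regular_borel_prob T extension"
proof -
  interpret prob_space extension
    by (rule prob_spaceI) (simp add: space_extension emeasure_extension_open inner_topspace)
  have outer_reg: "emeasure extension A = (INF U\<in>{U. openin T U \<and> A \<subseteq> U}. emeasure extension U)"
    if "A \<in> sets extension" for A
  proof -
    have "emeasure extension A = outer A"
      using that by (rule emeasure_extension)
    also have "\<dots> = (INF U\<in>{U. openin T U \<and> A \<subseteq> U}. emeasure extension U)"
      unfolding outer_def by (rule INF_cong) (simp_all add: emeasure_extension_open)
    finally show ?thesis .
  qed
  have inner_reg: "emeasure extension A = (SUP F\<in>{F. closedin T F \<and> F \<subseteq> A}. emeasure extension F)"
    if A: "A \<in> sets extension" for A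
  proof (rule antisym)
    have closed_sets: "F \<in> sets extension" if "closedin T F" for F
    proof -
      have "topspace T - F \<in> sets extension"
        using that by (intro open_in_sets_extension) (simp add: closedin_def)
      then have "space extension - (topspace T - F) \<in> sets extension"
        by (rule sets.compl_sets)
      then show ?thesis
        using that by (simp add: closedin_def double_diff space_extension)
    qed
    show "(SUP F\<in>{F. closedin T F \<and> F \<subseteq> A}. emeasure extension F) \<le> emeasure extension A"
      using A by (auto intro!: SUP_least emeasure_mono)
    show "emeasure extension A \<le> (SUP F\<in>{F. closedin T F \<and> F \<subseteq> A}. emeasure extension F)"
    proof (rule ennreal_le_epsilon)
      fix e :: real assume e: "0 < e"
      have cA: "topspace T - A \<in> sets extension"
        using A by (metis sets.compl_sets space_extension)
      have "emeasure extension (topspace T - A) < emeasure extension (topspace T - A) + ennreal e"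
        using e by (simp add: less_top[symmetric])
      \<comment> \<open>\<open>U\<close> exceeds the complement of \<open>A\<close> by measure at
        most \<open>e\<close>; its complement is a closed subset of \<open>A\<close> that misses no
        more than this excess.\<close>
      then obtain U where U: "openin T U" "topspace T - A \<subseteq> U"
        and lt: "emeasure extension U < emeasure extension (topspace T - A) + ennreal e"
        using outer_reg[OF cA] by (metis (no_types, lifting) INF_less_iff mem_Collect_eq)
      have cl: "closedin T (topspace T - U)" and sub: "topspace T - U \<subseteq> A"
        using U by auto
      have UA: "U - (topspace T - A) \<in> sets extension"
        using open_in_sets_extension[OF U(1)] cA by blast
      have "emeasure extension U = emeasure extension (topspace T - A) + emeasure extension (U - (topspace T - A))"
        using U UA cA by (subst plus_emeasure) (auto intro: arg_cong2[of _ _ _ _ emeasure])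
      with lt have small: "emeasure extension (U - (topspace T - A)) \<le> ennreal e"
        by (simp add: ennreal_add_left_cancel_less less_imp_le)
      have "emeasure extension A \<le> emeasure extension ((topspace T - U) \<union> (U - (topspace T - A)))"
        using A UA cl closed_sets sets.sets_into_space[OF A]
        by (intro emeasure_mono) (auto simp: space_extension)
      also have "\<dots> \<le> emeasure extension (topspace T - U) + emeasure extension (U - (topspace T - A))"
        using UA cl closed_sets by (intro emeasure_subadditive) auto
      also have "\<dots> \<le> (SUP F\<in>{F. closedin T F \<and> F \<subseteq> A}. emeasure extension F) + ennreal e"
        using cl sub small by (intro add_mono SUP_upper) auto
      finally show "emeasure extension A \<le> (SUP F\<in>{F. closedin T F \<and> F \<subseteq> A}. emeasure extension F) + ennreal e" .
    qed
  qed
  show ?thesis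
    unfolding regular_borel_prob_def
    using space_extension sets_extension prob_space_axioms outer_reg inner_reg by blast
qed

lemma strictly_positive_extension:
  assumes "\<And>C. C \<in> \<C> \<Longrightarrow> C \<noteq> {} \<Longrightarrow> m C > 0"
  shows "strictly_positive T extension"
  unfolding strictly_positive_def
proof (intro allI impI, elim conjE)
  fix U assume U: "openin T U" "U \<noteq> {}"
  then obtain C where "C \<in> \<C>" "C \<noteq> {}" "C \<subseteq> U"
    using base by blast
  then show "emeasure extension U > 0"
    using assms m_le_inner[of C U] by (fastforce simp: emeasure_extension_open[OF U(1)])
qed

end

subsection \<open>The Stone space of an algebra of sets of natural numbers\<close>

locale set_algebra =
  fixes \<A> :: "nat set set"
  assumes Compl_A: "A \<in> \<A> \<Longrightarrow> - A \<in> \<A>"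
    and Un_A: "A \<in> \<A> \<Longrightarrow> B \<in> \<A> \<Longrightarrow> A \<union> B \<in> \<A>"
    and finite_A: "finite A \<Longrightarrow> A \<in> \<A>"
begin

lemma UNIV_A: "UNIV \<in> \<A>"
  using Compl_A[OF finite_A[of "{}"]] by simp

lemma Int_A: "A \<in> \<A> \<Longrightarrow> B \<in> \<A> \<Longrightarrow> A \<inter> B \<in> \<A>"
  using Compl_A[OF Un_A[OF Compl_A Compl_A]] by simp

lemma Diff_A: "A \<in> \<A> \<Longrightarrow> B \<in> \<A> \<Longrightarrow> A - B \<in> \<A>"
  using Int_A[OF _ Compl_A] by (simp add: Diff_eq)

section \<open>Ultrafilters of the algebra\<close>

definition ult :: "nat set set set" where
  "ult = {u. u \<subseteq> \<A> \<and> {} \<notin> u \<and> (\<forall>A\<in>u. \<forall>B\<in>u. A \<inter> B \<in> u) \<and> (\<forall>A\<in>\<A>. A \<in> u \<or> - A \<in> u)}"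

lemma ult_Int: "u \<in> ult \<Longrightarrow> A \<in> u \<Longrightarrow> B \<in> u \<Longrightarrow> A \<inter> B \<in> u"
  and ult_sub: "u \<in> ult \<Longrightarrow> A \<in> u \<Longrightarrow> A \<in> \<A>"
  and ult_empty: "u \<in> ult \<Longrightarrow> {} \<notin> u"
  and ult_cases: "u \<in> ult \<Longrightarrow> A \<in> \<A> \<Longrightarrow> A \<in> u \<or> - A \<in> u"
  unfolding ult_def by blast+

lemma ult_Compl_iff: "u \<in> ult \<Longrightarrow> A \<in> \<A> \<Longrightarrow> - A \<in> u \<longleftrightarrow> A \<notin> u"
  using ult_cases[of u A] ult_Int[of u A "- A"] ult_empty[of u] by auto

text \<open>Upward closure is not built into \<open>ult\<close>: it follows because
  \<open>- B\<close> would be disjoint from a member.\<close>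

lemma ult_mono:
  assumes "u \<in> ult" "A \<in> u" "A \<subseteq> B" "B \<in> \<A>"
  shows "B \<in> u"
proof (rule ccontr)
  assume "B \<notin> u"
  then have "A \<inter> - B \<in> u"
    using assms ult_Int ult_Compl_iff by blast
  moreover have "A \<inter> - B = {}"
    using assms by blast
  ultimately show False
    using ult_empty[OF assms(1)] by simp
qed

lemma ult_Int_iff: "u \<in> ult \<Longrightarrow> A \<in> \<A> \<Longrightarrow> B \<in> \<A> \<Longrightarrow> A \<inter> B \<in> u \<longleftrightarrow> A \<in> u \<and> B \<in> u"
  using ult_Int ult_mono by (meson Int_lower1 Int_lower2)

lemma ult_Un_iff:
  assumes "u \<in> ult" "A \<in> \<A>" "B \<in> \<A>"
  shows "A \<union> B \<in> u \<longleftrightarrow> A \<in> u \<or> B \<in> u"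
proof -
  have "A \<union> B \<in> u \<longleftrightarrow> - (A \<union> B) \<notin> u"
    using assms ult_Compl_iff Un_A by blast
  also have "\<dots> \<longleftrightarrow> \<not> (- A \<in> u \<and> - B \<in> u)"
    using assms ult_Int_iff[OF assms(1) Compl_A Compl_A] by simp
  also have "\<dots> \<longleftrightarrow> A \<in> u \<or> B \<in> u"
    using assms ult_Compl_iff by blast
  finally show ?thesis .
qed

definition fip :: "nat set set \<Rightarrow> bool" where
  "fip F \<longleftrightarrow> (\<forall>S. finite S \<longrightarrow> S \<subseteq> F \<longrightarrow> \<Inter>S \<noteq> {})"

text \<open>Zorn's lemma gives a maximal family with the finite intersection property, and
  maximality makes it an ultrafilter.\<close>

lemma ult_extends_fip:
  assumes "F \<subseteq> \<A>" "fip F"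
  shows "\<exists>u\<in>ult. F \<subseteq> u"
proof -
  let ?P = "{G. F \<subseteq> G \<and> G \<subseteq> \<A> \<and> fip G}"
  have "\<exists>M\<in>?P. \<forall>G\<in>?P. M \<subseteq> G \<longrightarrow> G = M"
  proof (rule subset_Zorn_nonempty)
    show "?P \<noteq> {}"
      using assms by blast
    fix \<G> assume ne: "\<G> \<noteq> {}" and chain: "subset.chain ?P \<G>"
    have "fip (\<Union>\<G>)"
      unfolding fip_def
    proof (intro allI impI)
      fix S assume S: "finite S" "S \<subseteq> \<Union>\<G>"
      then obtain G where "G \<in> \<G>" "S \<subseteq> G"
        using finite_subset_Union_chain[OF S ne chain] by blast
      then show "\<Inter>S \<noteq> {}"
        using S(1) chain by (auto simp: subset.chain_def fip_def)
    qed
    then show "\<Union>\<G> \<in> ?P"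
      using ne chain by (auto simp: subset.chain_def)
  qed
  then obtain u where "u \<in> ?P" and max_u: "\<forall>G\<in>?P. u \<subseteq> G \<longrightarrow> G = u"
    by (rule bexE)
  then have u: "F \<subseteq> u" "u \<subseteq> \<A>" "fip u"
    by auto
  have max: "G = u" if "F \<subseteq> G" "G \<subseteq> \<A>" "fip G" "u \<subseteq> G" for G
    using max_u that by simp
  \<comment> \<open>Maximality in usable form: a set that meets every finite intersection can be
    added, hence is already present.\<close>
  have memI: "A \<in> u" if "A \<in> \<A>" "\<And>S. finite S \<Longrightarrow> S \<subseteq> u \<Longrightarrow> A \<inter> \<Inter>S \<noteq> {}" for A
  proof -
    have "fip (insert A u)"
      unfolding fip_def
    proof (intro allI impI)
      fix S assume S: "finite S" "S \<subseteq> insert A u"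
      have "A \<inter> \<Inter>(S - {A}) \<noteq> {}"
        using S by (intro that(2)) auto
      then show "\<Inter>S \<noteq> {}"
        by auto
    qed
    then have "insert A u = u"
      using u that(1) by (intro max) auto
    then show ?thesis
      by blast
  qed
  have Inter: "\<Inter>S \<noteq> {}" if "finite S" "S \<subseteq> u" for S
    using u(3) that by (auto simp: fip_def)
  have "{} \<notin> u"
    using Inter[of "{{}}"] by auto
  moreover have "A \<inter> B \<in> u" if AB: "A \<in> u" "B \<in> u" for A B
  proof (rule memI)
    show "A \<inter> B \<in> \<A>"
      using AB u Int_A by blast
    fix S assume "finite S" "S \<subseteq> u"
    then have "\<Inter>(insert A (insert B S)) \<noteq> {}"
      using AB by (intro Inter) auto
    then show "A \<inter> B \<inter> \<Inter>S \<noteq> {}"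
      by (simp add: Int_assoc)
  qed
  moreover have "A \<in> u \<or> - A \<in> u" if A: "A \<in> \<A>" for A
  proof (rule ccontr)
    assume "\<not> (A \<in> u \<or> - A \<in> u)"
    \<comment> \<open>Finite families blocking \<open>A\<close> and \<open>- A\<close>: their joint
      intersection would avoid both, although it is nonempty.\<close>
    then obtain S S' where S: "finite S" "S \<subseteq> u" "A \<inter> \<Inter>S = {}" "finite S'" "S' \<subseteq> u" "- A \<inter> \<Inter>S' = {}"
      using memI[OF A] memI[OF Compl_A[OF A]] by blast
    then have "\<Inter>S \<inter> \<Inter>S' \<noteq> {}"
      using Inter[of "S \<union> S'"] by (simp add: Inter_Un_distrib)
    then show False
      using S(3,6) by blast
  qed
  ultimately have "u \<in> ult"
    using u by (auto simp: ult_def)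
  then show ?thesis
    using u by blast
qed

definition hat :: "nat set \<Rightarrow> nat set set set" where
  "hat A = {u\<in>ult. A \<in> u}"

definition stone :: "nat set set topology" where
  "stone = topology (arbitrary union_of (\<lambda>U. U \<in> hat ` \<A>))"

lemma hat_Int: "A \<in> \<A> \<Longrightarrow> B \<in> \<A> \<Longrightarrow> hat (A \<inter> B) = hat A \<inter> hat B"
  and hat_Un: "A \<in> \<A> \<Longrightarrow> B \<in> \<A> \<Longrightarrow> hat (A \<union> B) = hat A \<union> hat B"
  and hat_Compl: "A \<in> \<A> \<Longrightarrow> hat (- A) = ult - hat A"
  and hat_empty: "hat {} = {}"
  by (auto simp: hat_def ult_Int_iff ult_Un_iff ult_Compl_iff ult_empty)

lemma hat_UNIV: "hat UNIV = ult"
  using hat_Compl[OF finite_A[of "{}"]] by (simp add: hat_empty)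

lemma openin_stone: "openin stone = arbitrary union_of (\<lambda>U. U \<in> hat ` \<A>)"
proof -
  have "istopology (arbitrary union_of (\<lambda>U. U \<in> hat ` \<A>))"
    by (rule istopology_base) (auto simp: hat_Int[symmetric] Int_A)
  then show ?thesis
    unfolding stone_def by (rule topology_inverse')
qed

lemma openin_hat: "A \<in> \<A> \<Longrightarrow> openin stone (hat A)"
  and stone_base: "openin stone U \<Longrightarrow> u \<in> U \<Longrightarrow> \<exists>A\<in>\<A>. u \<in> hat A \<and> hat A \<subseteq> U"
  using openin_stone unfolding openin_topology_base_unique by blast+

lemma topspace_stone: "topspace stone = ult"
proof
  show "ult \<subseteq> topspace stone"
    using openin_subset[OF openin_hat[OF UNIV_A]] by (simp add: hat_UNIV)
  show "topspace stone \<subseteq> ult"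
    using stone_base[OF openin_topspace] by (auto simp: hat_def)
qed

text \<open>If the complements of the basic sets subordinate to the cover had the finite
  intersection property, an ultrafilter containing them would lie in no cover member.\<close>

lemma compact_stone: "compact_space stone"
  unfolding compact_space
proof (intro allI impI, elim conjE)
  fix \<U> assume open_U: "\<forall>U\<in>\<U>. openin stone U" and cover: "\<Union>\<U> = topspace stone"
  let ?F = "{- A |A. A \<in> \<A> \<and> (\<exists>U\<in>\<U>. hat A \<subseteq> U)}"
  have "\<not> fip ?F"
  proof
    assume fip: "fip ?F"
    have "?F \<subseteq> \<A>"
      using Compl_A by auto
    from ult_extends_fip[OF this fip] obtain u where u: "u \<in> ult" "?F \<subseteq> u"
      by (rule bexE)
    then obtain U where "U \<in> \<U>" "u \<in> U"
      using cover topspace_stone by blast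
    then obtain A where "A \<in> \<A>" "u \<in> hat A" "hat A \<subseteq> U"
      using stone_base open_U by blast
    then have "- A \<in> u" "A \<in> u"
      using u \<open>U \<in> \<U>\<close> by (auto simp: hat_def)
    then show False
      using ult_Compl_iff[OF u(1) \<open>A \<in> \<A>\<close>] by blast
  qed
  then obtain S where S: "finite S" "S \<subseteq> ?F" "\<Inter>S = {}"
    unfolding fip_def by blast
  then have "\<forall>D\<in>S. \<exists>U. U \<in> \<U> \<and> hat (- D) \<subseteq> U"
    by fastforce
  from bchoice[OF this] obtain c where c: "\<And>D. D \<in> S \<Longrightarrow> c D \<in> \<U>" "\<And>D. D \<in> S \<Longrightarrow> hat (- D) \<subseteq> c D"
    by blast
  have S_A: "S \<subseteq> \<A>"
    using S(2) Compl_A by blast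
  \<comment> \<open>An ultrafilter missed by all \<open>c D\<close> contains every \<open>D\<close>
    in \<open>S\<close>, and therefore the empty intersection of \<open>S\<close>.\<close>
  have "u \<in> \<Union>(c ` S)" if u: "u \<in> ult" for u
  proof (rule ccontr)
    assume "u \<notin> \<Union>(c ` S)"
    then have "D \<in> u" if "D \<in> S" for D
      using c(2)[OF that] that u ult_cases[OF u, of D] S_A by (auto simp: hat_def)
    moreover have "\<Inter>S' \<in> u" if "finite S'" "S' \<subseteq> u" for S'
      using that
    proof (induction S' rule: finite_induct)
      case empty
      then show ?case
        using u UNIV_A by (metis hat_UNIV hat_def Inter_empty mem_Collect_eq)
    next
      case (insert D S')
      then show ?case
        using u ult_Int by simp
    qed
    ultimately have "\<Inter>S \<in> u"
      using S(1) by blast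
    then show False
      using S(3) ult_empty[OF u] by simp
  qed
  moreover have "\<Union>(c ` S) \<subseteq> topspace stone"
    using c(1) cover by blast
  ultimately have "\<Union>(c ` S) = topspace stone"
    using topspace_stone by blast
  then show "\<exists>\<F>. finite \<F> \<and> \<F> \<subseteq> \<U> \<and> \<Union>\<F> = topspace stone"
    using S(1) c(1) by (intro exI[of _ "c ` S"]) auto
qed

lemma Hausdorff_stone: "Hausdorff_space stone"
  unfolding Hausdorff_space_def topspace_stone
proof (intro allI impI, elim conjE)
  fix u v assume uv: "u \<in> ult" "v \<in> ult" "u \<noteq> v"
  \<comment> \<open>Distinct ultrafilters are incomparable: an inclusion between them would be an
    equality.\<close>
  have "\<exists>A\<in>\<A>. A \<in> u \<and> A \<notin> v"
  proof (rule ccontr)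
    assume "\<not> ?thesis"
    then have sub: "u \<subseteq> v"
      using ult_sub[OF uv(1)] by blast
    then obtain A where "A \<in> v" "A \<notin> u"
      using uv(3) by blast
    then have "- A \<in> u" "A \<in> \<A>"
      using uv ult_sub ult_Compl_iff by blast+
    then show False
      using sub \<open>A \<in> v\<close> ult_Compl_iff[OF uv(2)] by blast
  qed
  then obtain A where A: "A \<in> \<A>" "A \<in> u" "A \<notin> v"
    by blast
  have "openin stone (hat A) \<and> openin stone (hat (- A)) \<and> u \<in> hat A \<and> v \<in> hat (- A) \<and>
      disjnt (hat A) (hat (- A))"
    using A uv openin_hat Compl_A ult_Compl_iff by (auto simp: hat_Compl disjnt_def hat_def)
  then show "\<exists>U V. openin stone U \<and> openin stone V \<and> u \<in> U \<and> v \<in> V \<and> disjnt U V"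
    by blast
qed

section \<open>Principal ultrafilters and the compactification\<close>

definition point :: "nat \<Rightarrow> nat set set" where
  "point n = {A\<in>\<A>. n \<in> A}"

lemma point_ult: "point n \<in> ult"
  using Int_A Compl_A by (auto simp: point_def ult_def)

text \<open>Makes principal ultrafilters isolated, so that \<open>\<omega>\<close> embeds as an open
  discrete subspace.\<close>

lemma hat_singleton: "hat {n} = {point n}"
proof
  show "{point n} \<subseteq> hat {n}"
    using point_ult finite_A by (auto simp: hat_def point_def)
  show "hat {n} \<subseteq> {point n}"
  proof clarify
    fix u assume "u \<in> hat {n}"
    then have u: "u \<in> ult" "{n} \<in> u"
      by (auto simp: hat_def)
    have "A \<in> u \<longleftrightarrow> n \<in> A" if A: "A \<in> \<A>" for A
    proof
      show "A \<in> u" if "n \<in> A"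
        using ult_mono[OF u _ A] that by blast
      show "n \<in> A" if "A \<in> u"
      proof (rule ccontr)
        assume "n \<notin> A"
        then have "{n} \<inter> A = {}" by blast
        then show False
          using ult_Int[OF u \<open>A \<in> u\<close>] ult_empty[OF u(1)] by simp
      qed
    qed
    then show "u = point n"
      using ult_sub[OF u(1)] by (auto simp: point_def)
  qed
qed

text \<open>An infinite \<open>A\<close> together with all cofinite sets has the finite intersection
  property; an ultrafilter extending this family is not principal.\<close>

lemma hat_infinite_nonfinite:
  assumes A: "A \<in> \<A>" "infinite A"
  shows "hat A - range point \<noteq> {}"
proof -
  let ?F = "insert A {- B |B. finite B}"
  have fip: "fip ?F"
    unfolding fip_def
  proof (intro allI impI)
    fix S assume S: "finite S" "S \<subseteq> ?F"
    have "finite (\<Union>D\<in>S - {A}. - D)"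
      using S by auto
    then have "infinite (A - (\<Union>D\<in>S - {A}. - D))"
      using A(2) by (rule Diff_infinite_finite)
    moreover have "A - (\<Union>D\<in>S - {A}. - D) \<subseteq> \<Inter>S"
      by blast
    ultimately show "\<Inter>S \<noteq> {}"
      by (metis finite.emptyI subset_empty)
  qed
  have "?F \<subseteq> \<A>"
    using A Compl_A finite_A by auto
  from ult_extends_fip[OF this fip] obtain u where u: "u \<in> ult" "?F \<subseteq> u"
    by (rule bexE)
  have "u \<noteq> point n" for n
  proof
    assume "u = point n"
    moreover have "- {n} \<in> u"
      by (rule subsetD[OF u(2)], rule insertI2) simp
    ultimately show False
      by (simp add: point_def)
  qed
  then show ?thesis
    using u by (auto simp: hat_def)
qed

lemma hat_finite:
  assumes "finite A"
  shows "hat A \<subseteq> range point"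
  using assms
proof (induction A rule: finite_induct)
  case empty
  then show ?case by (simp add: hat_empty)
next
  case (insert n A)
  have "hat (insert n A) = hat {n} \<union> hat A"
    using insert finite_A hat_Un[of "{n}" A] by simp
  then show ?case
    using insert hat_singleton by simp
qed

text \<open>Density holds because a nonempty basic set \<open>hat A\<close> contains
  \<open>point n\<close> for each \<open>n\<close> in \<open>A\<close>.\<close>

lemma compactification_stone: "compactification_of_omega stone point"
proof -
  have inj: "inj point"
  proof (rule injI)
    fix n k assume "point n = point k"
    then have "{n} \<in> point k"
      using finite_A by (auto simp: point_def)
    then show "n = k"
      by (simp add: point_def)
  qed
  have sub: "subtopology stone (range point) = discrete_topology (range point)"
    unfolding eq_commute[of "subtopology stone (range point)"] discrete_topology_unique
  proof (intro conjI ballI)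
    show "topspace (subtopology stone (range point)) = range point"
      using point_ult by (auto simp: topspace_stone)
    fix u assume "u \<in> range point"
    then obtain n where "u = point n" by blast
    then show "openin (subtopology stone (range point)) {u}"
      using openin_hat[OF finite_A[of "{n}"]] unfolding openin_subtopology
      by (intro exI[of _ "{point n}"]) (auto simp: hat_singleton)
  qed
  have "embedding_map (discrete_topology UNIV) stone point"
    unfolding embedding_map_def sub topspace_discrete_topology
    by (rule bijective_open_imp_homeomorphic_map)
      (use inj in \<open>auto simp: open_map_def\<close>)
  moreover have "stone closure_of range point = topspace stone"
    unfolding dense_intersects_open
  proof (intro allI impI, elim conjE)
    fix U assume U: "openin stone U" "U \<noteq> {}"
    then obtain u A where A: "A \<in> \<A>" "u \<in> hat A" "hat A \<subseteq> U"
      using stone_base by blast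
    then have "A \<noteq> {}"
      using hat_empty by auto
    then obtain n where "n \<in> A" by blast
    then have "point n \<in> hat A"
      using A point_ult by (auto simp: hat_def point_def)
    then show "range point \<inter> U \<noteq> {}"
      using A by blast
  qed
  ultimately show ?thesis
    using compact_stone Hausdorff_stone by (simp add: compactification_of_omega_def)
qed

section \<open>The remainder of the compactification\<close>

definition growth :: "nat set set topology" where
  "growth = subtopology stone (topspace stone - range point)"

definition ghat :: "nat set \<Rightarrow> nat set set set" where
  "ghat A = hat A - range point"

lemma topspace_growth: "topspace growth = ult - range point"
  by (auto simp: growth_def topspace_stone)

lemma compact_growth: "compact_space growth"
proof -
  have "openin stone (\<Union>n. hat {n})"
    by (rule openin_Union) (auto intro!: openin_hat finite_A)
  moreover have "(\<Union>n. hat {n}) = range point"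
    by (auto simp: hat_singleton)
  ultimately have "openin stone (range point)"
    by simp
  then have "closedin stone (topspace stone - range point)"
    by (rule closedin_diff[OF closedin_topspace])
  then have "compactin stone (topspace stone - range point)"
    using closedin_compact_space compact_stone by blast
  then show ?thesis
    unfolding growth_def by (rule compact_space_subtopology)
qed

lemma openin_ghat: "A \<in> \<A> \<Longrightarrow> openin growth (ghat A)"
  unfolding growth_def openin_subtopology ghat_def
  using openin_hat[of A] openin_subset[OF openin_hat, of A] by (intro exI[of _ "hat A"]) auto

lemma growth_base:
  assumes "openin growth U" "u \<in> U"
  shows "\<exists>A\<in>\<A>. u \<in> ghat A \<and> ghat A \<subseteq> U"
proof -
  obtain V where V: "openin stone V" "U = V \<inter> (topspace stone - range point)"
    using assms(1) unfolding growth_def openin_subtopology by blast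
  then obtain A where "A \<in> \<A>" "u \<in> hat A" "hat A \<subseteq> V"
    using stone_base assms(2) by blast
  then show ?thesis
    using V assms(2) by (intro bexI[of _ A]) (auto simp: ghat_def hat_def topspace_stone)
qed

text \<open>With the Boolean laws below, \<open>ghat\<close> identifies two members of the algebra
  exactly when they differ by a finite set.\<close>

lemma ghat_eq_empty_iff: "A \<in> \<A> \<Longrightarrow> ghat A = {} \<longleftrightarrow> finite A"
  using hat_infinite_nonfinite[of A] hat_finite[of A] by (cases "finite A") (auto simp: ghat_def)

lemma ghat_Int: "A \<in> \<A> \<Longrightarrow> B \<in> \<A> \<Longrightarrow> ghat (A \<inter> B) = ghat A \<inter> ghat B"
  and ghat_Un: "A \<in> \<A> \<Longrightarrow> B \<in> \<A> \<Longrightarrow> ghat (A \<union> B) = ghat A \<union> ghat B"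
  and ghat_Diff: "A \<in> \<A> \<Longrightarrow> B \<in> \<A> \<Longrightarrow> ghat (A - B) = ghat A - ghat B"
  and ghat_UNIV: "ghat UNIV = topspace growth"
  by (auto simp: ghat_def hat_Int hat_Un hat_UNIV Diff_eq hat_Compl Compl_A topspace_growth)
    (auto simp: hat_def)

lemma growth_not_finite: "u \<in> topspace growth \<Longrightarrow> A \<in> u \<Longrightarrow> infinite A"
  using hat_finite[of A] by (auto simp: topspace_growth hat_def)

end

subsection \<open>The growth of the constructed algebra\<close>

lemma cylinder_eq_Int:
  "{y. \<forall>i<Suc n. y i = x i} = {y. \<forall>i<n. y i = x i} \<inter> (if x n then {y. y n} else - {y. y n})"
  by (auto simp: less_Suc_eq)

context set_algebra
begin

text \<open>An ultrafilter decides every set of indices of a clopen subset of \<open>2\<^sup>\<omega>\<close>, so it lies over a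
  unique point of \<open>2\<^sup>\<omega>\<close>.\<close>
definition shadow :: "nat set set \<Rightarrow> nat \<Rightarrow> bool" where
  "shadow u = (\<lambda>i. dense_trace {x. x i} \<in> u)"

text \<open>By induction on the length, \<open>u\<close> contains the trace of every cylinder around
  its shadow; one such cylinder lies inside \<open>X\<close>.\<close>

lemma dense_trace_mem_of_shadow:
  assumes A: "\<And>X. finitely_determined X \<Longrightarrow> dense_trace X \<in> \<A>"
    and u: "u \<in> ult" and X: "finitely_determined X" "shadow u \<in> X"
  shows "dense_trace X \<in> u"
proof -
  obtain n where n: "\<And>x y. (\<forall>i<n. x i = y i) \<Longrightarrow> x \<in> X \<Longrightarrow> y \<in> X"
    using X(1) unfolding finitely_determined_def by blast
  have "dense_trace {y. \<forall>i<n. y i = shadow u i} \<in> u" for n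
  proof (induction n)
    case 0
    have "UNIV \<in> u"
      using u by (metis hat_UNIV hat_def mem_Collect_eq)
    then show ?case
      by (simp add: dense_trace_def)
  next
    case (Suc n)
    let ?Y = "if shadow u n then {y. y n} else - {y. y n}"
    have "dense_trace ?Y \<in> u"
      using ult_Compl_iff[OF u A[OF finitely_determined_coordinate]]
      by (auto simp: shadow_def dense_trace_Compl)
    then have "dense_trace {y. \<forall>i<n. y i = shadow u i} \<inter> dense_trace ?Y \<in> u"
      using Suc u ult_Int by blast
    moreover have "dense_trace {y. \<forall>i<n. y i = shadow u i} \<inter> dense_trace ?Y
        = dense_trace {y. \<forall>i<Suc n. y i = shadow u i}"
      unfolding cylinder_eq_Int by (auto simp: dense_trace_def)
    ultimately show ?case
      by simp
  qed
  moreover have "{y. \<forall>i<n. y i = shadow u i} \<subseteq> X"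
    using n[of "shadow u"] X(2) by auto
  ultimately show ?thesis
    using ult_mono[OF u] A[OF X(1)] dense_trace_mono by blast
qed

end

section \<open>The strictly positive measure and non-separability\<close>

locale faithful_pair_algebra =
  fixes R
  assumes algebra: "pair_algebra R" and faithful: "faithful R" and base_R: "base_pairs \<subseteq> R"
begin

lemma fst_mem: "(A, X) \<in> R \<Longrightarrow> A \<in> fst ` R"
  by (rule image_eqI[of _ _ "(A, X)"]) simp_all

sublocale set_algebra "fst ` R"
proof
  show "- A \<in> fst ` R" if "A \<in> fst ` R" for A
    using that pair_algebra_Compl[OF algebra] by force
  show "A \<union> B \<in> fst ` R" if "A \<in> fst ` R" "B \<in> fst ` R" for A B
    using that pair_algebra_Un[OF algebra] by force
  show "A \<in> fst ` R" if "finite A" for A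
    using finite_base_pairs[OF that] base_R by force
qed

text \<open>A clopen set may come from many pairs, so some second component is chosen;
  \<open>content_ghat\<close> shows that its measure does not depend on the choice.\<close>

definition content :: "nat set set set \<Rightarrow> ennreal" where
  "content U = ennreal (measure cantor_measure (SOME X. \<exists>A. (A, X) \<in> R \<and> U = ghat A))"

text \<open>Equal \<open>ghat\<close> values mean that first components differ finitely, so by
  faithfulness second components differ by a null set.\<close>

lemma content_ghat:
  assumes AX: "(A, X) \<in> R"
  shows "content (ghat A) = ennreal (measure cantor_measure X)"
proof -
  interpret prob_space cantor_measure by (rule prob_space_cantor_measure)
  define Y where "Y = (SOME X. \<exists>B. (B, X) \<in> R \<and> ghat A = ghat B)"
  have "\<exists>B. (B, Y) \<in> R \<and> ghat A = ghat B"
    unfolding Y_def by (rule someI[of _ X]) (use AX in blast)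
  then obtain B where BY: "(B, Y) \<in> R" and eq: "ghat A = ghat B"
    by blast
  have sub: "measure cantor_measure X1 \<le> measure cantor_measure X2"
    if 1: "(A1, X1) \<in> R" and 2: "(A2, X2) \<in> R" and eq: "ghat A1 = ghat A2" for A1 X1 A2 X2
  proof -
    have mem: "A1 \<in> fst ` R" "A2 \<in> fst ` R"
      using 1 2 by (auto intro: fst_mem)
    then have "ghat (A1 - A2) = {}"
      using ghat_Diff eq by simp
    then have "finite (A1 - A2)"
      using ghat_eq_empty_iff[OF Diff_A[OF mem]] by simp
    then have null: "prob (X1 - X2) = 0"
      using faithful pair_algebra_Diff[OF algebra 1 2] unfolding faithful_def by blast
    have ev: "X1 \<in> events" "X2 \<in> events"
      using faithful 1 2 unfolding faithful_def by blast+
    then have "prob X1 \<le> prob (X2 \<union> (X1 - X2))"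
      by (intro finite_measure_mono) auto
    also have "\<dots> \<le> prob X2 + prob (X1 - X2)"
      using ev by (intro measure_Un_le) auto
    finally show ?thesis
      using null by simp
  qed
  have "prob Y = prob X"
    using sub[OF AX BY eq] sub[OF BY AX eq[symmetric]] by simp
  then show ?thesis
    by (simp add: content_def Y_def)
qed

sublocale clopen_content growth "ghat ` fst ` R" content
proof
  interpret prob_space cantor_measure by (rule prob_space_cantor_measure)
  show "compact_space growth"
    by (rule compact_growth)
  show "openin growth C" if "C \<in> ghat ` fst ` R" for C
    using that openin_ghat by blast
  show "\<exists>C\<in>ghat ` fst ` R. x \<in> C \<and> C \<subseteq> U" if "openin growth U" "x \<in> U" for U x
    using growth_base[OF that] by blast
  show "{} \<in> ghat ` fst ` R"
    using ghat_eq_empty_iff[OF finite_A[of "{}"]] finite_A[of "{}"] by (intro image_eqI[of _ _ "{}"]) auto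
  show "topspace growth \<in> ghat ` fst ` R"
    using UNIV_A by (intro image_eqI[of _ _ UNIV]) (simp_all add: ghat_UNIV)
  show "C \<union> D \<in> ghat ` fst ` R" if CD: "C \<in> ghat ` fst ` R" "D \<in> ghat ` fst ` R" for C D
  proof -
    obtain A where "C = ghat A" "A \<in> fst ` R"
      using CD(1) by (rule imageE)
    moreover obtain B where "D = ghat B" "B \<in> fst ` R"
      using CD(2) by (rule imageE)
    ultimately show ?thesis
      using ghat_Un Un_A by (intro image_eqI[of _ _ "A \<union> B"]) simp_all
  qed
  show "C - D \<in> ghat ` fst ` R" if CD: "C \<in> ghat ` fst ` R" "D \<in> ghat ` fst ` R" for C D
  proof -
    obtain A where "C = ghat A" "A \<in> fst ` R"
      using CD(1) by (rule imageE)
    moreover obtain B where "D = ghat B" "B \<in> fst ` R"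
      using CD(2) by (rule imageE)
    ultimately show ?thesis
      using ghat_Diff Diff_A by (intro image_eqI[of _ _ "A - B"]) simp_all
  qed
  show "content {} = 0"
    using content_ghat[OF pair_algebra_empty[OF algebra]] ghat_eq_empty_iff[OF finite_A[of "{}"]] by simp
  show "content (topspace growth) = 1"
    using content_ghat[OF pair_algebra_UNIV[OF algebra]] prob_space by (simp add: ghat_UNIV)
  show "content (C \<union> D) = content C + content D"
    if CD: "C \<in> ghat ` fst ` R" "D \<in> ghat ` fst ` R" "C \<inter> D = {}" for C D
  proof -
    obtain A X B Y where AX: "(A, X) \<in> R" "C = ghat A" and BY: "(B, Y) \<in> R" "D = ghat B"
      using CD(1,2) by auto
    have mem: "A \<in> fst ` R" "B \<in> fst ` R"
      using AX BY by (auto intro: fst_mem)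
    \<comment> \<open>Disjointness in the remainder only makes \<open>A \<inter> B\<close> finite,
      so \<open>X\<close> and \<open>Y\<close> are disjoint up to a null set.\<close>
    have "ghat (A \<inter> B) = {}"
      using CD(3) AX BY ghat_Int[OF mem] by simp
    then have "finite (A \<inter> B)"
      using ghat_eq_empty_iff[OF Int_A[OF mem]] by simp
    then have null: "prob (X \<inter> Y) = 0"
      using faithful pair_algebra_Int[OF algebra AX(1) BY(1)] unfolding faithful_def by blast
    have ev: "X \<in> events" "Y \<in> events"
      using faithful AX BY unfolding faithful_def by blast+
    have "prob (X \<union> Y) = prob X + prob Y - prob (X \<inter> Y)"
      using ev by (intro measure_Un3) (auto simp: fmeasurable_eq_sets)
    then have "prob (X \<union> Y) = prob X + prob Y"
      using null by simp
    moreover have "C \<union> D = ghat (A \<union> B)"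
      using AX BY ghat_Un[OF mem] by simp
    ultimately show ?thesis
      using content_ghat[OF AX(1)] content_ghat[OF BY(1)] AX(2) BY(2)
        content_ghat[OF pair_algebra_Un[OF algebra AX(1) BY(1)]] by simp
  qed
qed

text \<open>Faithfulness in the direction from infinite to non-null; this yields strict positivity
  of the extension.\<close>

lemma content_pos:
  assumes "C \<in> ghat ` fst ` R" "C \<noteq> {}"
  shows "content C > 0"
proof -
  obtain A X where AX: "(A, X) \<in> R" "C = ghat A"
    using assms(1) by auto
  then have "infinite A"
    using assms(2) ghat_eq_empty_iff[OF fst_mem] by auto
  then have "measure cantor_measure X \<noteq> 0"
    using faithful AX(1) unfolding faithful_def by blast
  then show ?thesis
    using content_ghat[OF AX(1)] AX(2) by (simp add: zero_less_measure_iff)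
qed

text \<open>A dense \<open>D\<close> would have a point \<open>u\<close> in the nonempty open set
  \<open>ghat B\<close>. The shadow of \<open>u\<close> lies in some \<open>W n\<close>, so
  \<open>u\<close> contains the finite set \<open>B \<inter> dense_trace (W n)\<close>, impossible
  in the remainder.\<close>

lemma growth_not_separable:
  assumes evades: "\<And>D. countable D \<Longrightarrow> evades R D"
  shows "\<not> separable_space growth"
proof
  assume "separable_space growth"
  then obtain D where D: "countable D" "D \<subseteq> topspace growth" "growth closure_of D = topspace growth"
    unfolding separable_space_def by blast
  have trace_mem: "dense_trace X \<in> fst ` R" if "finitely_determined X" for X
    using subsetD[OF base_R trace_base_pairs[OF that]] by (rule fst_mem)
  have "evades R (shadow ` D)"
    using D(1) by (intro evades) simp
  then obtain B C W where BC: "(B, C) \<in> R" "measure cantor_measure C > 0"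
    and W: "\<And>n. finitely_determined (W n)" "shadow ` D \<subseteq> (\<Union>n::nat. W n)"
      "\<And>n. finite (B \<inter> dense_trace (W n))"
    unfolding evades_def by blast
  have B: "B \<in> fst ` R"
    using BC(1) by (rule fst_mem)
  have "infinite B"
    using faithful BC unfolding faithful_def by force
  then have "ghat B \<noteq> {}"
    using ghat_eq_empty_iff[OF B] by simp
  then obtain u where u: "u \<in> D" "u \<in> ghat B"
    using D(3) openin_ghat[OF B] unfolding dense_intersects_open by blast
  then have ult: "u \<in> ult" "B \<in> u"
    by (auto simp: ghat_def hat_def)
  obtain n where "shadow u \<in> W n"
    using W(2) u(1) by blast
  then have "dense_trace (W n) \<in> u"
    using dense_trace_mem_of_shadow[OF trace_mem ult(1) W(1)] by blast
  then have "B \<inter> dense_trace (W n) \<in> u"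
    using ult ult_Int by blast
  then show False
    using growth_not_finite W(3) D(2) u(1) by blast
qed

end

text \<open>The cover is indexed by \<open>K\<close> and its members are replaced by their closures;
  each countable \<open>j\<close> in the cofinal family then gives a sequence of closed null
  sets.\<close>

lemma closed_null_sequences_of_star:
  fixes K :: "'k set"
  assumes "hypothesis_star K"
  shows "\<exists>(J :: 'k set set) E. (\<forall>B. unbounded_family B \<longrightarrow> |J| \<le>o |B| ) \<and>
    (\<forall>j\<in>J. \<forall>i::nat. closed (E j i) \<and> emeasure cantor_measure (E j i) = 0) \<and>
    (\<forall>D. countable D \<longrightarrow> (\<exists>j\<in>J. D \<subseteq> (\<Union>i. E j i)))"
proof -
  obtain \<C> where \<C>: "E_cover \<C>" "|\<C>| =o |K|"
    using assms unfolding hypothesis_star_def has_card_covE_def by blast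
  obtain J where J: "\<And>j. j \<in> J \<Longrightarrow> j \<subseteq> K \<and> countable j"
    "\<And>S. S \<subseteq> K \<Longrightarrow> countable S \<Longrightarrow> \<exists>j\<in>J. S \<subseteq> j"
    "\<And>B. unbounded_family B \<Longrightarrow> |J| \<le>o |B|"
    using assms unfolding hypothesis_star_def cof_countable_le_b_def by metis
  obtain \<phi> where \<phi>: "bij_betw \<phi> K \<C>"
    using ordIso_symmetric[OF \<C>(2)] card_of_ordIso by blast
  \<comment> \<open>The empty set is inserted so that \<open>Q j\<close> can be enumerated even when
    \<open>j\<close> is empty.\<close>
  define Q where "Q j = insert {} ((\<lambda>k. closure (\<phi> k)) ` j)" for j
  define E where "E j = from_nat_into (Q j)" for j
  have range_E: "range (E j) = Q j" if "j \<in> J" for j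
    unfolding E_def using J(1)[OF that] by (intro range_from_nat_into) (auto simp: Q_def)
  have "closed (E j i) \<and> emeasure cantor_measure (E j i) = 0" if j: "j \<in> J" for j and i :: nat
  proof -
    have "E j i \<in> Q j"
      using range_E[OF j] by blast
    moreover have "\<phi> k \<in> ideal_E" if "k \<in> j" for k
      using that J(1)[OF j] \<phi> \<C>(1) by (auto simp: E_cover_def bij_betw_def)
    ultimately show ?thesis
      by (auto simp: Q_def ideal_E_def)
  qed
  moreover have "\<exists>j\<in>J. D \<subseteq> (\<Union>i. E j i)" if D: "countable D" for D
  proof -
    have "\<exists>k\<in>K. x \<in> \<phi> k" for x
    proof -
      have "x \<in> \<Union>\<C>"
        using \<C>(1) by (simp add: E_cover_def)
      then show ?thesis
        using \<phi> by (auto simp: bij_betw_def)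
    qed
    \<comment> \<open>\<open>\<kappa>\<close> picks for each point a cover member containing it; the
      countable image of \<open>D\<close> is then captured by one \<open>j\<close>.\<close>
    then obtain \<kappa> where \<kappa>: "\<And>x. \<kappa> x \<in> K" "\<And>x. x \<in> \<phi> (\<kappa> x)"
      by metis
    obtain j where j: "j \<in> J" "\<kappa> ` D \<subseteq> j"
      using J(2)[of "\<kappa> ` D"] \<kappa>(1) D by auto
    have "x \<in> (\<Union>i. E j i)" if "x \<in> D" for x
    proof -
      have "closure (\<phi> (\<kappa> x)) \<in> Q j"
        using j that by (auto simp: Q_def)
      then have "closure (\<phi> (\<kappa> x)) \<in> range (E j)"
        using range_E[OF j(1)] by simp
      moreover have "x \<in> closure (\<phi> (\<kappa> x))"
        using \<kappa>(2) closure_subset by blast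
      ultimately show ?thesis
        by blast
    qed
    then show ?thesis
      using j(1) by blast
  qed
  ultimately show ?thesis
    using J(3) by (intro exI[of _ J] exI[of _ E]) simp
qed

theorem theorem1p1:
  fixes K :: "'k set"
  assumes "hypothesis_star K"
  shows "\<exists>(G :: nat set set topology) (e :: nat \<Rightarrow> nat set set).
           compactification_of_omega G e
           \<and> \<not> separable_space (subtopology G (topspace G - range e))
           \<and> (\<exists>\<mu>. regular_borel_prob (subtopology G (topspace G - range e)) \<mu>
                 \<and> strictly_positive (subtopology G (topspace G - range e)) \<mu>)"
proof -
  obtain J :: "'k set set" and E where J: "\<forall>B. unbounded_family B \<longrightarrow> |J| \<le>o |B|"
    and E: "\<forall>j\<in>J. \<forall>i::nat. closed (E j i) \<and> emeasure cantor_measure (E j i) = 0"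
    and cov: "\<forall>D. countable D \<longrightarrow> (\<exists>j\<in>J. D \<subseteq> (\<Union>i. E j i))"
    using closed_null_sequences_of_star[OF assms] by (elim exE conjE) (rule that)
  have "\<exists>R. pair_algebra R \<and> faithful R \<and> base_pairs \<subseteq> R \<and> (\<forall>j\<in>J. evades R (\<Union>i. E j i))"
  proof (rule faithful_algebra_exists)
    show "|J| \<le>o |B|" if "unbounded_family B" for B :: "(nat \<Rightarrow> nat) set"
      using J that by blast
  qed (use E in auto)
  then obtain R where R: "pair_algebra R" "faithful R" "base_pairs \<subseteq> R"
    and ev: "\<forall>j\<in>J. evades R (\<Union>i. E j i)"
    by (elim exE conjE) (rule that)
  interpret faithful_pair_algebra R
    by (rule faithful_pair_algebra.intro[OF R])
  have "evades R D" if D: "countable D" for D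
  proof -
    obtain j where j: "j \<in> J" "D \<subseteq> (\<Union>i. E j i)"
      using cov[rule_format, OF D] by (rule bexE)
    show ?thesis
      by (rule evades_subset[OF bspec[OF ev j(1)] j(2)])
  qed
  then have "\<not> separable_space growth"
    by (rule growth_not_separable)
  moreover have "\<exists>\<mu>. regular_borel_prob growth \<mu> \<and> strictly_positive growth \<mu>"
    using regular_extension strictly_positive_extension[OF content_pos] by (intro exI conjI)
  ultimately show ?thesis
    using compactification_stone unfolding growth_def
    by (intro exI[of _ stone] exI[of _ point] conjI)
qed

end
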